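(* Let $\lambda<1$ and $-\pi/2<\alpha<\pi/2$ with $\alpha\neq0$. Then $J[f]\in\mathcal{S}$ for every $f\in\mathcal{S}^*_\alpha(\lambda)$ if and only if $\cos\alpha\le \frac{1}{2(1-\lambda)}$. Moreover, if $-1/2\le\lambda<1$, then $J[f]\in\mathcal{S}$ for every $f\in\mathcal{S}^*_0(\lambda)$.
   Context: $\mathbb{D}$ is the open unit disk; $\mathcal{A}$ the class of analytic $f$ on $\mathbb{D}$ with $f(0)=0$, $f'(0)=1$; $\mathcal{S}\subset\mathcal{A}$ the univalent functions. For $\alpha\in(-\pi/2,\pi/2)$, $\lambda<1$, $\mathcal{S}^*_\alpha(\lambda)=\{f\in\mathcal{A}: f(z)\neq0 \text{ for } z\ne 0,\ \mathrm{Re}\,(e^{i\alpha}zf'(z)/f(z))>\lambda\cos\alpha \text{ on }\mathbb{D}\}$. The Alexander transform is $J[f](z)=\int_0^z f(w)/w\,dw$. *)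

theory Defs
  imports "HOL-Complex_Analysis.Complex_Analysis"
begin

definition unit_disk :: "complex set" where
  "unit_disk = ball 0 1"

definition classA :: "(complex \<Rightarrow> complex) set" where
  "classA = {f. f holomorphic_on unit_disk \<and> f 0 = 0 \<and> deriv f 0 = 1}"

definition classS :: "(complex \<Rightarrow> complex) set" where
  "classS = {f. f \<in> classA \<and> inj_on f unit_disk}"

text \<open>Spirallike class S*_alpha(lambda). The quotient z f'(z)/f(z) has a removable
  singularity at 0 (value 1); the condition is imposed at z \<noteq> 0, at z = 0 it
  reads cos alpha > lambda cos alpha, which holds automatically.\<close>
definition spirallike :: "real \<Rightarrow> real \<Rightarrow> (complex \<Rightarrow> complex) set" where
  "spirallike \<alpha> lam = {f. f \<in> classA \<and> (\<forall>z\<in>unit_disk. z \<noteq> 0 \<longrightarrow> f z \<noteq> 0) \<and>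
      (\<forall>z\<in>unit_disk. z \<noteq> 0 \<longrightarrow>
         Re (exp (\<i> * of_real \<alpha>) * z * deriv f z / f z) > lam * cos \<alpha>)}"

definition alexander :: "(complex \<Rightarrow> complex) \<Rightarrow> complex \<Rightarrow> complex" where
  "alexander f z = contour_integral (linepath 0 z) (\<lambda>w. f w / w)"

end

theory Submission
  imports Defs
begin

text \<open>
  Put \<open>\<mu> = (1 - lam) cos \<alpha> exp (- \<i> \<alpha>)\<close>. For \<open>f\<close> in the spirallike class write \<open>f z / z = exp (\<mu> L z)\<close> with
  \<open>L 0 = 0\<close>; the spirallike condition says \<open>Re (z L' z) > - 1\<close>, i.e. \<open>exp L\<close> is the derivative of a
  convex function, and \<open>F = J[f]\<close> satisfies \<open>F' = exp (\<mu> L)\<close>.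

  Univalence of \<open>F\<close> is obtained by embedding it as \<open>t = 0\<close> into an expanding (Loewner) chain
  \<open>E (t, z) = F (\<zeta>) + k t * \<zeta> * G \<zeta>\<close> with \<open>\<zeta> = exp (- t) * z\<close>, which for large \<open>t\<close> is close to a linear map.
  For \<open>\<bar>\<mu>\<bar> \<le> 1 / 2\<close>, \<open>\<mu> \<noteq> 1 / 2\<close>, the choice \<open>G = F'\<close>, \<open>k t = (exp (2 t) - 1) / (1 - 2 \<mu>)\<close> works by the
  Schwarz lemma. For real \<open>\<mu>\<close> in \<open>[1/2, 3/2]\<close> one takes \<open>G = exp L\<close>, \<open>k t = exp (M t) - 1\<close> with \<open>M\<close> large;
  this uses \<open>\<bar>Im L\<bar> < \<pi>\<close>.

  Conversely, for \<open>1 / 2 < s \<le> \<bar>\<mu>\<bar>\<close> the function \<open>z (1 - z) powr (- 2 s exp (- \<i> \<alpha>))\<close> is in the class and its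
  transform is an affine function of \<open>(1 - z) powr c\<close> with \<open>c = 1 - 2 s exp (- \<i> \<alpha>)\<close>. As \<open>\<alpha> \<noteq> 0\<close>, for \<open>s\<close> close
  to \<open>1 / 2\<close> the number \<open>c\<close> lies outside both disks \<open>\<bar>c - 1\<bar> \<le> 1\<close>, \<open>\<bar>c + 1\<bar> \<le> 1\<close> in which this power is univalent.
\<close>

section \<open>Injectivity along expanding chains of maps\<close>

text \<open>On the convex set \<open>f z - A * z\<close> has Lipschitz constant \<open>B\<close>,
  too small to cancel the linear part. This serves both for local injectivity of the chain and for
  its injectivity at a late time.\<close>

lemma inj_on_if_deriv_near_constant:
  fixes f f' :: "complex \<Rightarrow> complex"
  assumes "convex S"
    and der: "\<And>z. z \<in> S \<Longrightarrow> (f has_field_derivative f' z) (at z within S)"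
    and near: "\<And>z. z \<in> S \<Longrightarrow> norm (f' z - A) \<le> B" and "B < norm A"
  shows "inj_on f S"
proof (rule inj_onI)
  fix x y assume xy: "x \<in> S" "y \<in> S" "f x = f y"
  have "norm ((f x - A * x) - (f y - A * y)) \<le> B * norm (x - y)"
  proof (rule field_differentiable_bound[OF \<open>convex S\<close> _ _ \<open>x \<in> S\<close> \<open>y \<in> S\<close>])
    show "((\<lambda>z. f z - A * z) has_field_derivative (f' z - A)) (at z within S)" if "z \<in> S" for z
      using der[OF that] by (auto intro!: derivative_eq_intros)
  qed (use near in auto)
  then have "norm A * norm (x - y) \<le> B * norm (x - y)"
    using xy by (simp add: norm_mult[symmetric] algebra_simps norm_minus_commute)
  then show "x = y"
    using \<open>B < norm A\<close> by (auto simp: mult_le_cancel_right)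
qed

text \<open>The solution of \<open>E (t, z) = w\<close> moves with velocity \<open>- B / A\<close>. It is found as a fixed point of
  the simplified Newton map on a ball around the linear prediction.\<close>
lemma solution_follows_linear_prediction:
  fixes E :: "real \<times> complex \<Rightarrow> complex"
  assumes der: "(E has_derivative (\<lambda>(s, h). of_real s * B + A * h)) (at (t0, a))"
    and "A \<noteq> 0" and "d0 > 0"
    and cont: "\<And>t. t0 \<le> t \<Longrightarrow> continuous_on (ball a d0) (\<lambda>z. E (t, z))"
    and "\<epsilon> > 0"
  shows "\<exists>d>0. \<forall>s. 0 < s \<and> s < d \<longrightarrow>
           (\<exists>z. norm (z - (a - of_real s * (B / A))) \<le> \<epsilon> * s \<and> E (t0 + s, z) = E (t0, a))"
proof -
  \<comment> \<open>\<open>C * s\<close> bounds the distance from \<open>(t0, a)\<close> to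
    \<open>(t0 + s, z)\<close> for \<open>z\<close> in the ball: 1 for time,
    \<open>norm (B / A)\<close> for the drift, \<open>\<epsilon>\<close> for the radius. With
    \<open>\<eta>\<close> as below, the linearisation error divided by \<open>A\<close> is at most
    \<open>\<epsilon> * s\<close>.\<close>
  define C where "C = 1 + norm (B / A) + \<epsilon>"
  have "C > 0" using \<open>\<epsilon> > 0\<close> by (simp add: C_def add_pos_nonneg add_nonneg_pos)
  define \<eta> where "\<eta> = \<epsilon> * norm A / C"
  have "\<eta> > 0" using \<open>C > 0\<close> \<open>\<epsilon> > 0\<close> \<open>A \<noteq> 0\<close> by (simp add: \<eta>_def)
  obtain d1 where d1: "d1 > 0" and lin: "\<And>y. norm (y - (t0, a)) < d1 \<Longrightarrow>
      norm (E y - E (t0, a) - (case y - (t0, a) of (s, h) \<Rightarrow> of_real s * B + A * h)) \<le> \<eta> * norm (y - (t0, a))"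
    using der \<open>\<eta> > 0\<close> unfolding has_derivative_at_alt by blast
  define d where "d = min d0 d1 / C"
  have "d > 0" using \<open>C > 0\<close> d1 \<open>d0 > 0\<close> by (simp add: d_def)
  have "\<exists>z. norm (z - (a - of_real s * (B / A))) \<le> \<epsilon> * s \<and> E (t0 + s, z) = E (t0, a)"
    if s: "0 < s" "s < d" for s
  proof -
    define c where "c = a - of_real s * (B / A)"
    define N where "N = (\<lambda>z. z - (E (t0 + s, z) - E (t0, a)) / A)"
    have Cs: "C * s < d0" "C * s < d1"
      using s \<open>C > 0\<close> by (auto simp: d_def field_simps)
    have dist_a: "norm (z - a) \<le> (C - 1) * s" if "z \<in> cball c (\<epsilon> * s)" for z
    proof -
      have "norm (z - a) \<le> norm (z - c) + norm (c - a)"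
        using norm_triangle_ineq[of "z - c" "c - a"] by simp
      also have "norm (c - a) = s * norm (B / A)"
        using s by (simp add: c_def norm_mult norm_divide)
      finally show ?thesis
        using that by (simp add: C_def dist_norm norm_minus_commute algebra_simps)
    qed
    have dist_ta: "norm ((t0 + s, z) - (t0, a)) \<le> C * s" if "z \<in> cball c (\<epsilon> * s)" for z
    proof -
      have "norm ((t0 + s, z) - (t0, a)) \<le> norm s + norm (z - a)"
        by (simp add: norm_Pair sqrt_sum_squares_le_sum_abs order_trans[OF sqrt_sum_squares_le_sum_abs])
      then show ?thesis using dist_a[OF that] s by (simp add: algebra_simps)
    qed
    have "continuous_on (cball c (\<epsilon> * s)) N"
    proof -
      have "cball c (\<epsilon> * s) \<subseteq> ball a d0"
        using dist_a Cs s by (force simp: dist_norm norm_minus_commute algebra_simps)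
      then have "continuous_on (cball c (\<epsilon> * s)) (\<lambda>z. E (t0 + s, z))"
        using cont[of "t0 + s"] s continuous_on_subset by fastforce
      then show ?thesis unfolding N_def by (intro continuous_intros) (use \<open>A \<noteq> 0\<close> in auto)
    qed
    moreover have "N \<in> cball c (\<epsilon> * s) \<rightarrow> cball c (\<epsilon> * s)"
    proof
      fix z assume z: "z \<in> cball c (\<epsilon> * s)"
      define R where "R = E (t0 + s, z) - E (t0, a) - (of_real s * B + A * (z - a))"
      have "norm R \<le> \<eta> * norm ((t0 + s, z) - (t0, a))"
        using lin[of "(t0 + s, z)"] dist_ta[OF z] Cs by (simp add: R_def)
      also have "\<dots> \<le> \<eta> * (C * s)"
        using dist_ta[OF z] \<open>\<eta> > 0\<close> by (intro mult_left_mono) auto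
      also have "\<dots> = \<epsilon> * s * norm A"
        using \<open>C > 0\<close> by (simp add: \<eta>_def)
      finally have "norm R / norm A \<le> \<epsilon> * s"
        using \<open>A \<noteq> 0\<close> by (simp add: field_simps)
      moreover have "N z - c = - R / A"
        using \<open>A \<noteq> 0\<close> by (simp add: N_def c_def R_def field_simps)
      ultimately show "N z \<in> cball c (\<epsilon> * s)"
        by (metis dist_commute dist_norm mem_cball norm_divide norm_minus_cancel)
    qed
    \<comment> \<open>Brouwer's theorem is used because \<open>E\<close> is known to be
      differentiable only at \<open>(t0, a)\<close>, which does not make \<open>N\<close> a
      contraction.\<close>
    ultimately obtain z where z: "z \<in> cball c (\<epsilon> * s)" "N z = z"
      using brouwer[of "cball c (\<epsilon> * s)" N] mult_pos_pos[OF \<open>\<epsilon> > 0\<close> \<open>0 < s\<close>] by auto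
    then have "E (t0 + s, z) = E (t0, a)"
      using \<open>A \<noteq> 0\<close> by (simp add: N_def)
    then show ?thesis
      using z by (auto simp: c_def dist_norm norm_minus_commute)
  qed
  then show ?thesis using \<open>d > 0\<close> by blast
qed

text \<open>The squared norm is 1 - 2 s Re p + s^2 |p|^2, and for s < Re p / |p|^2 the quadratic
  term uses up at most half of the linear gain. The remaining decay absorbs the error of the linear
  prediction at boundary points.\<close>

lemma norm_one_minus_small_multiple:
  fixes p :: complex
  assumes "Re p > 0"
  shows "\<exists>d>0. \<forall>s. 0 < s \<and> s < d \<longrightarrow> norm (1 - of_real s * p) \<le> 1 - s * Re p / 2"
proof -
  have p: "norm p > 0" using assms by auto
  define d where "d = Re p / (norm p)\<^sup>2"
  have "d > 0" using assms p by (simp add: d_def)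
  have "norm (1 - of_real s * p) \<le> 1 - s * Re p / 2" if s: "0 < s" "s < d" for s
  proof -
    have sp: "s * (norm p)\<^sup>2 < Re p" using s p by (simp add: d_def field_simps)
    have "s * Re p * Re p \<le> s * (norm p)\<^sup>2"
      using complex_Re_le_cmod[of p] assms s
      by (simp add: power2_eq_square mult.assoc mult_mono)
    then have "(s * Re p) * Re p < 1 * Re p" using sp by linarith
    then have "s * Re p < 1" using assms by (simp only: mult_less_cancel_right_pos)
    have "(norm (1 - of_real s * p))\<^sup>2 = 1 - 2 * s * Re p + s * (s * (norm p)\<^sup>2)"
      unfolding cmod_power2 by (simp add: power2_eq_square algebra_simps)
    also have "\<dots> \<le> 1 - 2 * s * Re p + s * Re p"
      using sp s by (intro add_left_mono mult_left_mono) auto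
    also have "\<dots> \<le> (1 - s * Re p / 2)\<^sup>2"
      using zero_le_power2[of "s * Re p"] by (simp add: power2_eq_square algebra_simps)
    finally show ?thesis
      by (rule power2_le_imp_le) (use \<open>s * Re p < 1\<close> in linarith)
  qed
  then show ?thesis using \<open>d > 0\<close> by blast
qed

text \<open>Along the chain \<open>z \<mapsto> E (t, z)\<close> a collision of two points persists for slightly
  larger \<open>t\<close>, because the solutions of \<open>E (t, z) = w\<close> are pushed into the disk as \<open>t\<close> grows.
  Hence there is no last collision time, and so no collision at all.\<close>
lemma inj_on_of_expanding_chain:
  fixes E dt dz :: "real \<times> complex \<Rightarrow> complex"
  assumes r: "0 < r" "r < R" and "T > 0"
    and der: "\<And>t z. 0 \<le> t \<Longrightarrow> norm z < R \<Longrightarrow>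
      (E has_derivative (\<lambda>(s, h). of_real s * dt (t, z) + dz (t, z) * h)) (at (t, z))"
    and cont: "continuous_on ({0..} \<times> ball 0 R) dz"
    and nz: "\<And>t z. 0 \<le> t \<Longrightarrow> norm z \<le> r \<Longrightarrow> dz (t, z) \<noteq> 0"
    and expanding: "\<And>t z. 0 < t \<Longrightarrow> norm z = r \<Longrightarrow> Re (dt (t, z) / (z * dz (t, z))) > 0"
    and injT: "inj_on (\<lambda>z. E (T, z)) (cball 0 r)"
  shows "inj_on (\<lambda>z. E (0, z)) (ball 0 r)"
proof (rule ccontr)
  assume "\<not> ?thesis"
  then obtain a0 b0 where ab0: "norm a0 < r" "norm b0 < r" "a0 \<noteq> b0" "E (0, a0) = E (0, b0)"
    by (auto simp: inj_on_def)

  have der_z: "((\<lambda>z. E (t, z)) has_field_derivative dz (t, z)) (at z)" if "0 \<le> t" "norm z < R" for t z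
  proof -
    have "((\<lambda>z. (t, z)) has_derivative (\<lambda>h. (0, h))) (at z)"
      by (auto intro!: derivative_eq_intros)
    from has_derivative_compose[OF this der[OF that]] show ?thesis
      by (simp add: has_field_derivative_def)
  qed
  have contE: "isCont E (t, z)" if "0 \<le> t" "norm z < R" for t z
    using der[OF that] has_derivative_continuous by blast

  have push: "\<forall>\<^sub>F s in at_right 0. \<exists>z. norm z \<le> r \<and> norm (z - a) < e \<and> E (t + s, z) = E (t, a)"
    if "0 \<le> t" "norm a < r \<or> 0 < t \<and> norm a = r" "e > 0" for t a e
  proof -
    have a: "norm a \<le> r" "norm a < R" using that r by auto
    define A where "A = dz (t, a)"
    define B where "B = dt (t, a)"
    have "A \<noteq> 0" using nz that a by (simp add: A_def)
    \<comment> \<open>The linear prediction will stay at depth at least \<open>p * s\<close> inside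
      the ball of radius \<open>r\<close>. Taking \<open>p\<close> also as the tolerance of the
      prediction keeps the true solution in the closed ball.\<close>
    define p where "p = (if norm a < r then (r - norm a) else r * Re (B / (a * A)) / 2)"
    have "p > 0" using that expanding[of t a] r by (auto simp: p_def A_def B_def)
    have evball: "\<forall>\<^sub>F s in at_right 0. norm (a - of_real s * (B / A)) \<le> r - p * s"
    proof (cases "norm a < r")
      case True
      have "((\<lambda>s. norm (a - of_real s * (B / A)) + p * s) \<longlongrightarrow> norm (a - of_real 0 * (B / A)) + p * 0) (at_right 0)"
        by (intro tendsto_intros)
      then have "\<forall>\<^sub>F s in at_right 0. norm (a - of_real s * (B / A)) + p * s < r"
        using True by (auto dest!: order_tendstoD)
      then show ?thesis by eventually_elim auto
    next
      case False
      then have *: "norm a = r" "0 < t" using that by auto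
      have "Re (B / (a * A)) > 0" using expanding[OF *(2,1)] by (simp add: A_def B_def)
      from norm_one_minus_small_multiple[OF this] obtain d where "d > 0" and
        d: "\<And>s. 0 < s \<and> s < d \<Longrightarrow> norm (1 - of_real s * (B / (a * A))) \<le> 1 - s * Re (B / (a * A)) / 2"
        by blast
      have "norm (a - of_real s * (B / A)) \<le> r - p * s" if "0 < s" "s < d" for s
      proof -
        have "a - of_real s * (B / A) = a * (1 - of_real s * (B / (a * A)))"
          using * r by (auto simp: field_simps)
        then have "norm (a - of_real s * (B / A)) = r * norm (1 - of_real s * (B / (a * A)))"
          using * by (simp only: norm_mult)
        also have "\<dots> \<le> r * (1 - s * Re (B / (a * A)) / 2)"
          using d[of s] that r by (intro mult_left_mono) auto
        finally show ?thesis using False by (simp add: p_def algebra_simps)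
      qed
      then show ?thesis
        using \<open>d > 0\<close> unfolding eventually_at_right_field by auto
    qed
    have "continuous_on (ball a (R - norm a)) (\<lambda>z. E (t', z))" if "t \<le> t'" for t'
    proof (rule DERIV_continuous_on)
      fix z assume "z \<in> ball a (R - norm a)"
      then have "norm z < R" using norm_triangle_ineq2[of z a] by (auto simp: dist_norm norm_minus_commute)
      then show "((\<lambda>z. E (t', z)) has_field_derivative dz (t', z)) (at z within ball a (R - norm a))"
        using der_z[of t' z] that \<open>0 \<le> t\<close> has_field_derivative_at_within by fastforce
    qed
    note cont_a = this
    have der_a: "(E has_derivative (\<lambda>(s, h). of_real s * B + A * h)) (at (t, a))"
      using der[OF \<open>0 \<le> t\<close> a(2)] by (simp add: A_def B_def)
    from solution_follows_linear_prediction[OF der_a \<open>A \<noteq> 0\<close> _ cont_a \<open>p > 0\<close>] a(2)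
    obtain d where "d > 0" and d: "\<And>s. 0 < s \<and> s < d \<Longrightarrow>
        \<exists>z. norm (z - (a - of_real s * (B / A))) \<le> p * s \<and> E (t + s, z) = E (t, a)"
      by auto
    then have "\<forall>\<^sub>F s in at_right 0.
        \<exists>z. norm (z - (a - of_real s * (B / A))) \<le> p * s \<and> E (t + s, z) = E (t, a)"
      unfolding eventually_at_right_field by auto
    moreover have "\<forall>\<^sub>F s in at_right 0. p * s + s * norm (B / A) < e"
    proof -
      have "((\<lambda>s. p * s + s * norm (B / A)) \<longlongrightarrow> p * 0 + 0 * norm (B / A)) (at_right 0)"
        by (intro tendsto_intros)
      then show ?thesis using \<open>e > 0\<close> by (auto dest!: order_tendstoD)
    qed
    moreover have "\<forall>\<^sub>F s::real in at_right 0. 0 < s" by (simp add: eventually_at_right_less)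
    ultimately show ?thesis using evball
    proof eventually_elim
      case (elim s)
      then obtain z where z: "norm (z - (a - of_real s * (B / A))) \<le> p * s" "E (t + s, z) = E (t, a)" by blast
      have "norm z \<le> r"
        using z elim norm_triangle_ineq2[of z "a - of_real s * (B / A)"] by linarith
      moreover have "norm (z - a) \<le> p * s + s * norm (B / A)"
        using z(1) norm_triangle_ineq4[of "z - (a - of_real s * (B / A))" "of_real s * (B / A)"] \<open>0 < s\<close>
        by (simp add: norm_mult norm_divide)
      ultimately show ?case using z elim by auto
    qed
  qed

  have push2: "\<exists>s>0. s < \<delta> \<and> (\<exists>a' b'. norm a' \<le> r \<and> norm b' \<le> r \<and> a' \<noteq> b' \<and> E (t + s, a') = E (t + s, b'))"
    if "0 \<le> t" "norm a < r \<or> 0 < t \<and> norm a = r" "norm b < r \<or> 0 < t \<and> norm b = r" "a \<noteq> b"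
       "E (t, a) = E (t, b)" "\<delta> > 0" for t a b \<delta>
  proof -
    \<comment> \<open>Each solution is followed within half the distance of the two points, so they
      cannot merge.\<close>
    define e where "e = norm (a - b) / 2"
    have "e > 0" using \<open>a \<noteq> b\<close> by (simp add: e_def)
    have "\<forall>\<^sub>F s in at_right 0. s < \<delta>" using \<open>\<delta> > 0\<close> eventually_at_right_field by blast
    moreover have "\<forall>\<^sub>F s::real in at_right 0. 0 < s" by (simp add: eventually_at_right_less)
    ultimately have "\<forall>\<^sub>F s in at_right 0. 0 < s \<and> s < \<delta> \<and>
       (\<exists>z. norm z \<le> r \<and> norm (z - a) < e \<and> E (t + s, z) = E (t, a)) \<and>
       (\<exists>z. norm z \<le> r \<and> norm (z - b) < e \<and> E (t + s, z) = E (t, b))"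
      using push[OF that(1,2) \<open>e > 0\<close>] push[OF that(1,3) \<open>e > 0\<close>] by eventually_elim auto
    then obtain s where s: "0 < s" "s < \<delta>"
       "\<exists>z. norm z \<le> r \<and> norm (z - a) < e \<and> E (t + s, z) = E (t, a)"
       "\<exists>z. norm z \<le> r \<and> norm (z - b) < e \<and> E (t + s, z) = E (t, b)"
      using eventually_happens'[OF trivial_limit_at_right_real] by blast
    then obtain a' b' where ab': "norm a' \<le> r" "norm (a' - a) < e" "E (t + s, a') = E (t, a)"
        "norm b' \<le> r" "norm (b' - b) < e" "E (t + s, b') = E (t, b)" by blast
    have "a' \<noteq> b'"
    proof
      assume "a' = b'"
      then have "norm (a - b) \<le> norm (a' - a) + norm (b' - b)"
        using norm_triangle_ineq4[of "a' - b" "a' - a"] by simp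
      then show False using ab' by (simp add: e_def)
    qed
    then show ?thesis using s ab' that by metis
  qed

  define K where "K = {(t, a, b). t \<in> {0..T} \<and> a \<in> cball 0 r \<and> b \<in> cball 0 r \<and> a \<noteq> b \<and> E (t, a) = E (t, b)}"
  \<comment> \<open>Injectivity on a neighbourhood that is uniform in nearby times prevents
    colliding points from merging in a limit, which makes \<open>K\<close> closed although its
    definition contains \<open>a \<noteq> b\<close>.\<close>
  have local_inj: "\<exists>e>0. \<forall>t' x y. 0 \<le> t' \<and> \<bar>t' - t\<bar> < e \<and> x \<in> ball a e \<and> y \<in> ball a e \<and> E (t', x) = E (t', y) \<longrightarrow> x = y"
    if "0 \<le> t" "norm a \<le> r" for t a
  proof -
    have "0 < norm (dz (t, a)) / 2" using nz[OF that] by simp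
    moreover have "(t, a) \<in> {0..} \<times> ball 0 R" using that r by auto
    ultimately obtain e1 where "e1 > 0" and
      e1: "\<And>y. y \<in> {0..} \<times> ball 0 R \<Longrightarrow> dist y (t, a) < e1 \<Longrightarrow> dist (dz y) (dz (t, a)) < norm (dz (t, a)) / 2"
      using cont unfolding continuous_on_iff by metis
    define e where "e = min (e1 / 2) (R - r)"
    have "e > 0" using \<open>e1 > 0\<close> r by (simp add: e_def)
    have "inj_on (\<lambda>z. E (t', z)) (ball a e)" if t': "0 \<le> t'" "\<bar>t' - t\<bar> < e" for t'
    proof (rule inj_on_if_deriv_near_constant[where f' = "\<lambda>z. dz (t', z)" and A = "dz (t, a)" and B = "norm (dz (t, a)) / 2"])
      fix z assume z: "z \<in> ball a e"
      have zR: "norm z < R"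
        using z norm_triangle_ineq2[of z a] \<open>norm a \<le> r\<close> by (auto simp: e_def dist_norm norm_minus_commute)
      show "((\<lambda>z. E (t', z)) has_field_derivative dz (t', z)) (at z within ball a e)"
        using der_z[OF t'(1) zR] has_field_derivative_at_within by blast
      have "dist (t', z) (t, a) \<le> \<bar>t' - t\<bar> + dist z a"
        unfolding dist_Pair_Pair by (rule order_trans[OF sqrt_sum_squares_le_sum_abs]) (simp add: dist_real_def)
      also have "\<dots> < e1" using t' z by (auto simp: e_def dist_commute)
      finally show "norm (dz (t', z) - dz (t, a)) \<le> norm (dz (t, a)) / 2"
        using e1[of "(t', z)"] t' zR by (simp add: dist_norm)
    qed (use \<open>0 < norm (dz (t, a)) / 2\<close> in auto)
    then show ?thesis using \<open>e > 0\<close> unfolding inj_on_def by blast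
  qed
  have "closed K"
    unfolding closed_sequential_limits
  proof safe
    fix x t a b assume x: "\<forall>n. x n \<in> K" and lim: "x \<longlonglongrightarrow> (t, a, b)"
    define u v w where "u = (\<lambda>n. fst (x n))" and "v = (\<lambda>n. fst (snd (x n)))" and "w = (\<lambda>n. snd (snd (x n)))"
    have limu: "u \<longlonglongrightarrow> t" and limv: "v \<longlonglongrightarrow> a" and limw: "w \<longlonglongrightarrow> b"
      using tendsto_fst[OF lim] tendsto_fst[OF tendsto_snd[OF lim]] tendsto_snd[OF tendsto_snd[OF lim]]
      by (auto simp: u_def v_def w_def)
    have K: "u n \<in> {0..T}" "v n \<in> cball 0 r" "w n \<in> cball 0 r" "v n \<noteq> w n" "E (u n, v n) = E (u n, w n)" for n
      using x[rule_format, of n] by (auto simp: K_def u_def v_def w_def split: prod.splits)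
    have t: "t \<in> {0..T}" and a: "a \<in> cball 0 r" and b: "b \<in> cball 0 r"
      using K limu limv limw closed_sequentially[OF closed_atLeastAtMost] closed_sequentially[OF closed_cball] by blast+
    have "(\<lambda>n. E (u n, v n)) \<longlonglongrightarrow> E (t, a)" "(\<lambda>n. E (u n, w n)) \<longlonglongrightarrow> E (t, b)"
      using t a b r by (auto intro!: isCont_tendsto_compose[OF contE] tendsto_intros limu limv limw)
    then have "E (t, a) = E (t, b)" using K(5) LIMSEQ_unique by auto
    moreover have "a \<noteq> b"
    proof
      assume "a = b"
      obtain e where "e > 0" and e: "\<And>t' x y. 0 \<le> t' \<and> \<bar>t' - t\<bar> < e \<and> x \<in> ball a e \<and> y \<in> ball a e \<and> E (t', x) = E (t', y) \<Longrightarrow> x = y"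
        using local_inj[of t a] t a by auto
      have "\<forall>\<^sub>F n in sequentially. dist (u n) t < e \<and> dist (v n) a < e \<and> dist (w n) a < e"
        using limu limv limw \<open>a = b\<close> \<open>e > 0\<close> by (intro eventually_conj tendstoD) auto
      then obtain n where "dist (u n) t < e" "dist (v n) a < e" "dist (w n) a < e"
        unfolding eventually_sequentially by blast
      then have "v n = w n" using e[of "u n" "v n" "w n"] K[of n] by (simp add: dist_commute abs_minus_commute dist_real_def)
      then show False using K by blast
    qed
    ultimately show "(t, a, b) \<in> K" using t a b by (simp add: K_def)
  qed
  moreover have "bounded K"
  proof (rule bounded_subset)
    show "bounded ({0..T} \<times> cball (0::complex) r \<times> cball (0::complex) r)"
      by (intro bounded_Times bounded_cball bounded_closed_interval)
  qed (auto simp: K_def)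
  ultimately have "compact (fst ` K)"
    by (intro compact_continuous_image continuous_intros) (simp add: compact_eq_bounded_closed)
  \<comment> \<open>The last collision time must be positive, since its points may lie on the
    boundary circle.\<close>
  moreover have ex_pos: "\<exists>t\<in>fst ` K. t > 0"
  proof -
    from push2[of 0 a0 b0 T] ab0 \<open>T > 0\<close> obtain s a b where "0 < s" "s < T"
      "norm a \<le> r" "norm b \<le> r" "a \<noteq> b" "E (s, a) = E (s, b)" by auto
    then have "(s, a, b) \<in> K" by (simp add: K_def)
    then show ?thesis using \<open>0 < s\<close> by force
  qed
  ultimately obtain t where t: "t \<in> fst ` K" "\<And>s. s \<in> fst ` K \<Longrightarrow> s \<le> t"
    using compact_attains_sup[of "fst ` K"] by blast
  then have "t > 0" using ex_pos by force
  obtain a b where ab: "(t, a, b) \<in> K" using t by auto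
  have "t \<noteq> T" using ab injT by (auto simp: K_def inj_on_def)
  then have "t < T" using ab by (auto simp: K_def)
  have "norm a < r \<or> 0 < t \<and> norm a = r" "norm b < r \<or> 0 < t \<and> norm b = r"
    using ab \<open>t > 0\<close> by (auto simp: K_def)
  with push2[of t a b "T - t"] ab \<open>t > 0\<close> \<open>t < T\<close> obtain s a' b' where "0 < s" "s < T - t"
      "norm a' \<le> r" "norm b' \<le> r" "a' \<noteq> b'" "E (t + s, a') = E (t + s, b')"
    by (auto simp: K_def)
  then have "(t + s, a', b') \<in> K" using \<open>t > 0\<close> by (simp add: K_def)
  then show False using t(2)[of "t + s"] \<open>0 < s\<close> by force
qed

text \<open>The chain is \<open>E\<close>, with \<open>\<zeta>\<close> the point \<open>z\<close>
  shrunk by \<open>exp (- t)\<close>; \<open>k 0 = 0\<close> makes \<open>F\<close> its initial map.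
  The quotient \<open>dt / (z * dz)\<close> equals \<open>k' * G / D - 1\<close> at
  \<open>\<zeta>\<close>, so the last hypothesis is the expansion condition. Growth of
  \<open>k\<close> makes \<open>k T * G 0\<close> dominate the derivative near 0 for large
  \<open>T\<close>.\<close>

lemma inj_on_of_radial_chain:
  fixes F G F' G' :: "complex \<Rightarrow> complex" and k k' :: "real \<Rightarrow> complex"
  assumes r: "0 < r" "r < 1"
    and derF: "\<And>z. norm z < 1 \<Longrightarrow> (F has_field_derivative F' z) (at z)"
    and derG: "\<And>z. norm z < 1 \<Longrightarrow> (G has_field_derivative G' z) (at z)"
    and k0: "k 0 = 0"
    and derk: "\<And>t. 0 \<le> t \<Longrightarrow> (k has_vector_derivative k' t) (at t)"
    and kinf: "filterlim (\<lambda>t. norm (k t)) at_top at_top"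
    and F'0: "\<And>z. norm z \<le> r \<Longrightarrow> F' z \<noteq> 0" and "G 0 \<noteq> 0"
    and expanding: "\<And>t z. 0 < t \<Longrightarrow> norm z \<le> r * exp (- t) \<Longrightarrow>
       Re (k' t * G z / (F' z + k t * (G z + z * G' z))) > 1"
  shows "inj_on F (ball 0 r)"
proof -
  define \<zeta> where "\<zeta> = (\<lambda>(t::real, z). exp (of_real (- t)) * z :: complex)"
  define D where "D = (\<lambda>(t, z). F' z + k t * (G z + z * G' z))"
  define E where "E = (\<lambda>p. F (\<zeta> p) + k (fst p) * (\<zeta> p * G (\<zeta> p)))"
  define dz where "dz = (\<lambda>p. exp (of_real (- fst p)) * D (fst p, \<zeta> p))"
  define dt where "dt = (\<lambda>p. \<zeta> p * (k' (fst p) * G (\<zeta> p) - D (fst p, \<zeta> p)))"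
  have exp_le: "exp (- t) \<le> 1" if "0 \<le> t" for t :: real using that by simp
  have norm_\<zeta>: "norm (\<zeta> (t, z)) = exp (- t) * norm z" for t z
    by (simp add: \<zeta>_def norm_mult)
  have \<zeta>1: "norm (\<zeta> (t, z)) < 1" if "0 \<le> t" "norm z < 1" for t z
  proof -
    have "exp (- t) * norm z \<le> 1 * norm z" using exp_le[OF that(1)] by (intro mult_right_mono) auto
    then show ?thesis using that by (simp add: norm_\<zeta>)
  qed
  have F'_cont: "continuous_on (ball 0 1) F'" and G_cont: "continuous_on (ball 0 1) G"
    and G'_cont: "continuous_on (ball 0 1) G'"
  proof -
    have hol: "F holomorphic_on ball 0 1" "G holomorphic_on ball 0 1"
      unfolding holomorphic_on_open[OF open_ball] using derF derG mem_ball_0 by blast+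
    have eq: "deriv F z = F' z" "deriv G z = G' z" if "z \<in> ball 0 1" for z
      using that DERIV_imp_deriv[OF derF] DERIV_imp_deriv[OF derG] by auto
    have "F' holomorphic_on ball 0 1" "G' holomorphic_on ball 0 1"
      using holomorphic_transform[OF holomorphic_deriv[OF hol(1) open_ball] eq(1)]
        holomorphic_transform[OF holomorphic_deriv[OF hol(2) open_ball] eq(2)] by blast+
    then show "continuous_on (ball 0 1) F'" "continuous_on (ball 0 1) G'" "continuous_on (ball 0 1) G"
      using hol holomorphic_on_imp_continuous_on by auto
  qed
  have D0: "D (t, z) \<noteq> 0" if "0 \<le> t" "norm z \<le> r * exp (- t)" for t z
  proof (cases "t = 0")
    case True then show ?thesis using F'0 that k0 by (simp add: D_def)
  next
    case False then show ?thesis using expanding[of t z] that by (auto simp: D_def)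
  qed

  obtain T where "T > 0" and injT: "inj_on (\<lambda>z. E (T, z)) (cball 0 r)"
  proof -
    define P where "P = (\<lambda>z. G z + z * G' z)"
    have P_cont: "continuous_on (ball 0 1) P"
      unfolding P_def using G_cont G'_cont by (intro continuous_intros)
    have "isCont F' 0" "isCont P 0"
      using F'_cont P_cont continuous_on_eq_continuous_at[OF open_ball] by force+
    then have lim: "(F' \<longlongrightarrow> F' 0) (nhds 0)" "(P \<longlongrightarrow> P 0) (nhds 0)"
      by (auto simp: isCont_def continuous_at tendsto_at_iff_tendsto_nhds)
    \<comment> \<open>Near 0 the derivative \<open>D (T, z)\<close> differs from
      \<open>k T * G 0\<close> by at most \<open>M + norm (k T) * g\<close>. Once
      \<open>M < g * norm (k T)\<close>, this is less than half of
      \<open>norm (k T * G 0)\<close>.\<close>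
    define g where "g = norm (G 0) / 4"
    have "g > 0" using \<open>G 0 \<noteq> 0\<close> by (simp add: g_def)
    have "\<forall>\<^sub>F z in nhds 0. dist (F' z) (F' 0) < 1 \<and> dist (P z) (P 0) < g"
      using lim \<open>g > 0\<close> by (intro eventually_conj tendstoD) auto
    then obtain e where "e > 0" and e: "\<And>z. norm z < e \<Longrightarrow> dist (F' z) (F' 0) < 1 \<and> dist (P z) (P 0) < g"
      unfolding eventually_nhds_metric by auto
    define M where "M = norm (F' 0) + 1"
    have "\<forall>\<^sub>F t in at_top. norm (k t) > M / g" using kinf by (simp add: filterlim_at_top_dense)
    moreover have "\<forall>\<^sub>F t::real in at_top. exp (- t) < e"
    proof -
      have "((\<lambda>t::real. exp (- t)) \<longlongrightarrow> 0) at_top"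
        using filterlim_compose[OF exp_at_bot filterlim_uminus_at_bot_at_top] .
      then show ?thesis using \<open>e > 0\<close> order_tendstoD by blast
    qed
    moreover have "\<forall>\<^sub>F t::real in at_top. t > 0" by (rule eventually_gt_at_top)
    ultimately have "\<forall>\<^sub>F t in at_top. norm (k t) > M / g \<and> exp (- t) < e \<and> t > 0"
      by eventually_elim auto
    then obtain T where T: "norm (k T) > M / g" "exp (- T) < e" "T > 0"
      using eventually_happens'[OF trivial_limit_at_top_linorder] by blast
    have kT: "M < g * norm (k T)" using T \<open>g > 0\<close> by (simp add: field_simps)
    have "M > 0" unfolding M_def by (smt (verit) norm_ge_zero)
    let ?c = "min e 1"
    have "inj_on (\<lambda>z. F z + k T * (z * G z)) (ball 0 ?c)"
    proof (rule inj_on_if_deriv_near_constant[where f' = "\<lambda>z. D (T, z)" and A = "k T * G 0" and B = "M + norm (k T) * g"])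
      fix z :: complex assume "z \<in> ball 0 ?c"
      then have z: "norm z < e" "norm z < 1" by auto
      show "((\<lambda>z. F z + k T * (z * G z)) has_field_derivative D (T, z)) (at z within ball 0 ?c)"
        by (rule has_field_derivative_at_within)
          (auto intro!: derivative_eq_intros derF[OF z(2)] derG[OF z(2)] simp: D_def algebra_simps)
      have "norm (F' z) \<le> M"
        using e[OF z(1)] norm_triangle_ineq2[of "F' z" "F' 0"] by (simp add: M_def dist_norm)
      moreover have "norm (k T * (P z - P 0)) \<le> norm (k T) * g"
        using e[OF z(1)] by (simp add: norm_mult dist_norm mult_left_mono)
      moreover have "D (T, z) - k T * G 0 = F' z + k T * (P z - P 0)"
        by (simp add: D_def P_def algebra_simps)
      ultimately show "norm (D (T, z) - k T * G 0) \<le> M + norm (k T) * g"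
        by (simp add: norm_triangle_mono)
    next
      have "M + norm (k T) * g < 2 * g * norm (k T)" using kT by simp
      also have "\<dots> \<le> norm (k T * G 0)" using \<open>g > 0\<close> by (simp add: g_def norm_mult)
      finally show "M + norm (k T) * g < norm (k T * G 0)" .
    qed simp
    moreover have "inj_on (\<lambda>z. \<zeta> (T, z)) (cball 0 r)" by (auto simp: inj_on_def \<zeta>_def)
    moreover have "(\<lambda>z. \<zeta> (T, z)) ` cball 0 r \<subseteq> ball 0 ?c"
    proof clarsimp
      fix z :: complex assume z: "norm z \<le> r"
      have "norm (\<zeta> (T, z)) \<le> exp (- T) * 1" unfolding norm_\<zeta> using z r by (intro mult_left_mono) auto
      then show "norm (\<zeta> (T, z)) < e \<and> norm (\<zeta> (T, z)) < 1" using T \<zeta>1[of T z] z r by auto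
    qed
    ultimately have "inj_on ((\<lambda>z. F z + k T * (z * G z)) \<circ> (\<lambda>z. \<zeta> (T, z))) (cball 0 r)"
      using comp_inj_on inj_on_subset by blast
    then show ?thesis using that[OF T(3)] by (simp add: E_def o_def)
  qed

  have "inj_on (\<lambda>z. E (0, z)) (ball 0 r)"
  proof (rule inj_on_of_expanding_chain[OF r \<open>T > 0\<close> _ _ _ _ injT, of dt dz])
    fix t :: real and z :: complex assume tz: "0 \<le> t" "norm z < 1"
    have d\<zeta>: "(\<zeta> has_derivative (\<lambda>(s, h). exp (of_real (- t)) * h - of_real s * \<zeta> (t, z))) (at (t, z))"
    proof -
      have "((\<lambda>p. of_real (- fst p) :: complex) has_derivative (\<lambda>q. of_real (- fst q))) (at (t, z))"
        by (auto intro!: derivative_eq_intros)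
      from has_derivative_compose[OF this DERIV_exp[THEN has_field_derivative_imp_has_derivative]]
      have "((\<lambda>p. exp (of_real (- fst p)) :: complex) has_derivative
          (\<lambda>q. exp (of_real (- t)) * of_real (- fst q))) (at (t, z))" by simp
      from has_derivative_mult[OF this has_derivative_snd[OF has_derivative_ident]]
      have "((\<lambda>p. exp (of_real (- fst p)) * snd p :: complex) has_derivative
          (\<lambda>p. exp (of_real (- t)) * snd p - of_real (fst p) * (exp (of_real (- t)) * z))) (at (t, z))"
        by (simp add: algebra_simps)
      then show ?thesis by (simp add: \<zeta>_def case_prod_unfold)
    qed
    have dF: "((\<lambda>p. F (\<zeta> p)) has_derivative (\<lambda>q. F' (\<zeta> (t, z)) * (case q of (s, h) \<Rightarrow> exp (of_real (- t)) * h - of_real s * \<zeta> (t, z)))) (at (t, z))"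
      using has_derivative_compose[OF d\<zeta> derF[OF \<zeta>1[OF tz], THEN has_field_derivative_imp_has_derivative]] .
    have dG: "((\<lambda>p. G (\<zeta> p)) has_derivative (\<lambda>q. G' (\<zeta> (t, z)) * (case q of (s, h) \<Rightarrow> exp (of_real (- t)) * h - of_real s * \<zeta> (t, z)))) (at (t, z))"
      using has_derivative_compose[OF d\<zeta> derG[OF \<zeta>1[OF tz], THEN has_field_derivative_imp_has_derivative]] .
    have dk: "((\<lambda>p. k (fst p)) has_derivative (\<lambda>q. of_real (fst q) * k' t)) (at (t, z))"
    proof -
      have "(k has_derivative (\<lambda>s. s *\<^sub>R k' t)) (at (fst (t, z)))"
        using derk[OF tz(1)] by (simp add: has_vector_derivative_def)
      from has_derivative_compose[OF has_derivative_fst[OF has_derivative_ident] this] show ?thesis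
        by (simp add: scaleR_conv_of_real)
    qed
    show "(E has_derivative (\<lambda>(s, h). of_real s * dt (t, z) + dz (t, z) * h)) (at (t, z))"
      unfolding E_def
      by (rule has_derivative_eq_rhs[OF has_derivative_add[OF dF has_derivative_mult[OF dk has_derivative_mult[OF d\<zeta> dG]]]])
         (auto simp: fun_eq_iff dt_def dz_def D_def algebra_simps)
  next
    have c\<zeta>: "continuous_on ({0..} \<times> ball 0 1) \<zeta>"
      unfolding \<zeta>_def case_prod_unfold by (intro continuous_intros)
    have img: "\<zeta> ` ({0..} \<times> ball 0 1) \<subseteq> ball 0 1" using \<zeta>1 by auto
    have "continuous_on {0..} k"
      using derk by (intro continuous_at_imp_continuous_on) (auto intro: has_vector_derivative_continuous)
    then have ck: "continuous_on ({0..} \<times> ball (0::complex) 1) (\<lambda>p. k (fst p))"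
      by (rule continuous_on_compose2) (auto intro: continuous_intros)
    show "continuous_on ({0..} \<times> ball 0 1) dz"
      unfolding dz_def D_def prod.case
      by (intro continuous_intros ck c\<zeta> continuous_on_compose2[OF F'_cont c\<zeta> img]
        continuous_on_compose2[OF G_cont c\<zeta> img] continuous_on_compose2[OF G'_cont c\<zeta> img])
  next
    fix t :: real and z :: complex assume tz: "0 \<le> t" "norm z \<le> r"
    then show "dz (t, z) \<noteq> 0" using D0[of t "\<zeta> (t, z)"] by (simp add: dz_def norm_\<zeta> mult.commute)
  next
    fix t :: real and z :: complex assume tz: "0 < t" "norm z = r"
    then have "z \<noteq> 0" using r by auto
    have n: "norm (\<zeta> (t, z)) \<le> r * exp (- t)" using tz by (simp add: norm_\<zeta>)
    have D: "D (t, \<zeta> (t, z)) \<noteq> 0" using D0[of t] n tz by simp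
    have "dt (t, z) / (z * dz (t, z)) = k' t * G (\<zeta> (t, z)) / D (t, \<zeta> (t, z)) - 1"
      using D \<open>z \<noteq> 0\<close> by (simp add: dt_def dz_def \<zeta>_def field_simps)
    then show "Re (dt (t, z) / (z * dz (t, z))) > 0"
      using expanding[OF tz(1) n] by (simp add: D_def)
  qed
  then show ?thesis by (simp add: E_def \<zeta>_def k0)
qed

section \<open>Univalence criteria for powers of the derivative of a convex function\<close>

text \<open>The Moebius map w / (2 + w) sends the half plane Re w > -1 to the unit disk and fixes 0,
  so the Schwarz lemma applies to its composition with \<open>g\<close>.\<close>

lemma norm_le_of_Re_gt_minus_one:
  assumes hol: "g holomorphic_on ball 0 1" and "g 0 = 0"
    and Re: "\<And>z. norm z < 1 \<Longrightarrow> Re (g z) > - 1" and z: "norm z < 1"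
  shows "norm (g z) \<le> norm z * norm (2 + g z)"
proof -
  have ne: "2 + g w \<noteq> 0" if "norm w < 1" for w
    using Re[OF that] by (auto simp: complex_eq_iff)
  have lt: "norm (g w) < norm (2 + g w)" if "norm w < 1" for w
  proof -
    have "(norm (g w))\<^sup>2 < (norm (2 + g w))\<^sup>2"
      unfolding cmod_power2 using Re[OF that] by (simp add: power2_eq_square algebra_simps)
    then show ?thesis by (simp add: power2_less_imp_less)
  qed
  have "norm (g z / (2 + g z)) \<le> norm z"
  proof (rule Schwarz_Lemma(1))
    show "(\<lambda>w. g w / (2 + g w)) holomorphic_on ball 0 1"
      using hol ne by (intro holomorphic_intros) auto
    show "norm (g w / (2 + g w)) < 1" if "norm w < 1" for w
      using lt[OF that] ne[OF that] by (simp add: norm_divide)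
  qed (use z \<open>g 0 = 0\<close> in auto)
  then show ?thesis using ne[OF z] by (simp add: norm_divide field_simps)
qed

text \<open>The hypothesis places \<open>q\<close> in the open disk with diameter from 0 to
  \<open>M\<close>, which inversion turns into a half plane. Expansion of both chains is checked in
  this form.\<close>

lemma Re_of_real_divide_gt_one:
  fixes q :: complex assumes "(norm q)\<^sup>2 < M * Re q"
  shows "Re (of_real M / q) > 1"
proof -
  have "q \<noteq> 0" using assms by auto
  have "Re (of_real M / q) = M * Re q / (norm q)\<^sup>2"
    by (simp add: Re_divide cmod_power2)
  also have "\<dots> > 1" using assms \<open>q \<noteq> 0\<close> by (subst less_divide_eq_1_pos) auto
  finally show ?thesis .
qed

text \<open>The chain argument runs on compact disks inside the unit disk, so the criteria are first
  proved for radii below 1.\<close>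

lemma inj_on_unit_ball_if_smaller_balls:
  fixes F :: "complex \<Rightarrow> complex"
  assumes "\<And>r. 0 < r \<Longrightarrow> r < 1 \<Longrightarrow> inj_on F (ball 0 r)"
  shows "inj_on F (ball 0 1)"
proof (rule inj_onI)
  fix x y assume xy: "x \<in> ball 0 1" "y \<in> ball 0 1" "F x = F y"
  define r where "r = (max (norm x) (norm y) + 1) / 2"
  have "0 < r" "r < 1" "x \<in> ball 0 r" "y \<in> ball 0 r"
    using xy by (auto simp: r_def max_def field_simps add_pos_nonneg)
  then show "x = y" using assms[of r] xy by (auto dest: inj_onD)
qed

text \<open>This is Ahlfors' univalence criterion
  \<open>\<bar>c \<bar>z\<bar>\<^sup>2 + (1 - \<bar>z\<bar>\<^sup>2) z F''(z) / F'(z)\<bar> \<le> 1\<close> with \<open>c = - 2 \<mu>\<close>.\<close>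
lemma inj_on_small_power_of_convex_derivative:
  assumes holL: "L holomorphic_on ball 0 1" and "L 0 = 0"
    and Re: "\<And>z. norm z < 1 \<Longrightarrow> Re (z * deriv L z) > - 1"
    and derF: "\<And>z. norm z < 1 \<Longrightarrow> (F has_field_derivative exp (\<mu> * L z)) (at z)"
    and \<mu>: "norm \<mu> \<le> 1 / 2" "\<mu> \<noteq> 1 / 2"
  shows "inj_on F (ball 0 1)"
proof (rule inj_on_unit_ball_if_smaller_balls)
  fix r :: real assume r: "0 < r" "r < 1"
  \<comment> \<open>With \<rho> = exp (- t) and u = z L'(z), this \<open>k\<close> turns the
    expansion quotient into 2 / (1 + y), where y = \<mu> ((1 - \<rho>^2) u - 2 \<rho>^2). It remains
    to show |y| < 1.\<close>
  define k where "k = (\<lambda>t::real. of_real (exp (2 * t) - 1) / (1 - 2 * \<mu>))"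
  define k' where "k' = (\<lambda>t::real. of_real (2 * exp (2 * t)) / (1 - 2 * \<mu>))"
  have \<mu>0: "1 - 2 * \<mu> \<noteq> 0" using \<mu>(2) by (auto simp: field_simps)
  have derL: "(L has_field_derivative deriv L z) (at z)" if "norm z < 1" for z
    using holomorphic_derivI[OF holL open_ball] that by auto
  show "inj_on F (ball 0 r)"
  proof (rule inj_on_of_radial_chain[OF r derF, where k = k and k' = k'
        and G' = "\<lambda>z. exp (\<mu> * L z) * (\<mu> * deriv L z)"])
    show "((\<lambda>z. exp (\<mu> * L z)) has_field_derivative exp (\<mu> * L z) * (\<mu> * deriv L z)) (at z)"
      if "norm z < 1" for z
      using derL[OF that] by (auto intro!: derivative_eq_intros)
    show "k 0 = 0" by (simp add: k_def)
    show "(k has_vector_derivative k' t) (at t)" for t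
    proof -
      have "((\<lambda>t. exp (2 * t) - 1) has_real_derivative 2 * exp (2 * t)) (at t)"
        by (auto intro!: derivative_eq_intros)
      from has_vector_derivative_of_real[OF this, where 'a = complex]
      show ?thesis unfolding k_def k'_def by (intro has_vector_derivative_divide)
    qed
    have "filterlim (\<lambda>t::real. (exp (2 * t) - 1) / norm (1 - 2 * \<mu>)) at_top at_top"
    proof (rule filterlim_at_top_mono)
      show "filterlim (\<lambda>t. t * (1 / norm (1 - 2 * \<mu>))) at_top at_top"
        using \<mu>0 by (intro filterlim_at_top_mult_tendsto_pos[OF tendsto_const _ filterlim_ident]) auto
      show "\<forall>\<^sub>F t in at_top. t * (1 / norm (1 - 2 * \<mu>)) \<le> (exp (2 * t) - 1) / norm (1 - 2 * \<mu>)"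
        using eventually_ge_at_top[of 0]
      proof eventually_elim
        case (elim t)
        have "t \<le> exp (2 * t) - 1" using exp_ge_add_one_self[of "2 * t"] elim by linarith
        then show ?case by (simp add: divide_right_mono)
      qed
    qed
    moreover have "\<forall>\<^sub>F t in at_top. (exp (2 * t) - 1) / norm (1 - 2 * \<mu>) = norm (k t)"
      using eventually_ge_at_top[of 0]
      by eventually_elim (simp add: k_def norm_divide del: of_real_diff)
    ultimately show "filterlim (\<lambda>t. norm (k t)) at_top at_top"
      by (simp cong: filterlim_cong)
    show "1 < Re (k' t * exp (\<mu> * L z) / (exp (\<mu> * L z) + k t * (exp (\<mu> * L z) + z * (exp (\<mu> * L z) * (\<mu> * deriv L z)))))"
      if t: "0 < t" and z: "norm z \<le> r * exp (- t)" for t z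
    proof -
      define \<rho> where "\<rho> = exp (- t)"
      have \<rho>: "0 < \<rho>" "\<rho> < 1" and e2: "exp (2 * t) = 1 / \<rho>\<^sup>2"
        using t by (auto simp: \<rho>_def exp_minus power2_eq_square field_simps simp flip: exp_add)
      have z\<rho>: "norm z < \<rho>" using z r \<rho> by (smt (verit) \<rho>_def mult_less_cancel_right2)
      define u where "u = z * deriv L z"
      define y where "y = \<mu> * (of_real (1 - \<rho>\<^sup>2) * u - of_real (2 * \<rho>\<^sup>2))"
      have z1: "norm z < 1" using z\<rho> \<rho> by simp
      have "norm u \<le> norm z * norm (2 + u)"
        unfolding u_def
        by (rule norm_le_of_Re_gt_minus_one[OF _ _ Re z1])
           (auto intro!: holomorphic_intros holL holomorphic_deriv)
      moreover have "norm (2 + u) > 0"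
        using Re[OF z1] by (auto simp: u_def complex_eq_iff)
      ultimately have "norm u < \<rho> * norm (2 + u)"
        using z\<rho> by (smt (verit) mult_less_cancel_right_pos)
      then have "(norm u)\<^sup>2 < (\<rho> * norm (2 + u))\<^sup>2" by (intro power_strict_mono) auto
      then have 1: "(Re u)\<^sup>2 + (Im u)\<^sup>2 < \<rho>\<^sup>2 * ((2 + Re u)\<^sup>2 + (Im u)\<^sup>2)"
        unfolding power_mult_distrib cmod_power2 by simp
      have \<rho>2: "\<rho>\<^sup>2 < 1" "0 < \<rho>\<^sup>2" using \<rho> by (auto simp: power_less_one_iff)
      have "(norm (of_real (1 - \<rho>\<^sup>2) * u - of_real (2 * \<rho>\<^sup>2)))\<^sup>2
          = (1 - \<rho>\<^sup>2) * ((1 - \<rho>\<^sup>2) * ((Re u)\<^sup>2 + (Im u)\<^sup>2) - 4 * \<rho>\<^sup>2 * Re u) + 4 * (\<rho>\<^sup>2)\<^sup>2"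
        unfolding cmod_power2 by (simp add: power2_eq_square algebra_simps)
      \<comment> \<open>Expanding the Schwarz bound |u|^2 < \<rho>^2 |2 + u|^2 gives (1 - \<rho>^2)
        |u|^2 - 4 \<rho>^2 Re u < 4 \<rho>^2, exactly the bracket above.\<close>
      also have "\<dots> < (1 - \<rho>\<^sup>2) * (4 * \<rho>\<^sup>2) + 4 * (\<rho>\<^sup>2)\<^sup>2"
      proof -
        have "(1 - \<rho>\<^sup>2) * ((Re u)\<^sup>2 + (Im u)\<^sup>2) - 4 * \<rho>\<^sup>2 * Re u < 4 * \<rho>\<^sup>2"
          using 1 by (simp add: power2_eq_square algebra_simps)
        then show ?thesis using \<rho>2 by (intro add_strict_right_mono mult_strict_left_mono) auto
      qed
      also have "\<dots> = 4 * \<rho>\<^sup>2" by (simp add: power2_eq_square algebra_simps)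
      also have "\<dots> \<le> 2\<^sup>2" using \<rho>2 by simp
      finally have "norm (of_real (1 - \<rho>\<^sup>2) * u - of_real (2 * \<rho>\<^sup>2)) < 2"
        by (rule power2_less_imp_less) simp
      then have "norm y < 1"
        using mult_right_mono[OF \<mu>(1) norm_ge_zero, of "(of_real (1 - \<rho>\<^sup>2) * u - of_real (2 * \<rho>\<^sup>2))"]
        unfolding y_def norm_mult by linarith
      have k'0: "k' t \<noteq> 0" using \<mu>0 by (simp add: k'_def)
      have "k' t * exp (\<mu> * L z) / (exp (\<mu> * L z) + k t * (exp (\<mu> * L z) + z * (exp (\<mu> * L z) * (\<mu> * deriv L z))))
          = k' t / (1 + k t * (1 + \<mu> * u))"
      proof -
        have "exp (\<mu> * L z) + k t * (exp (\<mu> * L z) + z * (exp (\<mu> * L z) * (\<mu> * deriv L z)))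
            = (1 + k t * (1 + \<mu> * u)) * exp (\<mu> * L z)" by (simp add: u_def algebra_simps)
        then show ?thesis by simp
      qed
      also have "1 + k t * (1 + \<mu> * u) = (1 + y) * (k' t / 2)"
        using \<rho>(1) \<mu>0 unfolding k_def k'_def e2 y_def by (simp add: field_simps)
      also have "k' t / ((1 + y) * (k' t / 2)) = 2 / (1 + y)"
        using k'0 by (simp add: divide_simps)
      finally have fin: "k' t * exp (\<mu> * L z) / (exp (\<mu> * L z) + k t * (exp (\<mu> * L z) + z * (exp (\<mu> * L z) * (\<mu> * deriv L z))))
          = 2 / (1 + y)" .
      show ?thesis
      proof -
        have "(norm y)\<^sup>2 < 1" using \<open>norm y < 1\<close> by (simp add: power_less_one_iff)
        then have "(norm (1 + y))\<^sup>2 < 2 * Re (1 + y)"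
          unfolding cmod_power2 by (simp add: power2_eq_square algebra_simps)
        from Re_of_real_divide_gt_one[OF this] show ?thesis using fin by simp
      qed
    qed
  qed auto
qed

text \<open>On the circle \<open>\<bar>z\<bar> = r\<close> the function \<open>\<theta> + Im L\<close> increases with \<open>\<theta>\<close>, and \<open>Im L\<close> has mean zero there.
  Both together bound \<open>Im L\<close>; the mean is taken by means of the periodic antiderivative \<open>- Re A\<close> where
  \<open>z A'(z) = L z\<close>.\<close>
lemma abs_Im_log_convex_derivative_less_pi:
  assumes holL: "L holomorphic_on ball 0 1" and "L 0 = 0"
    and Re: "\<And>z. norm z < 1 \<Longrightarrow> Re (z * deriv L z) > - 1" and z: "norm z < 1"
  shows "\<bar>Im (L z)\<bar> < pi"
proof -
  have derL: "(L has_field_derivative deriv L z) (at z)" if "norm z < 1" for z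
    using holomorphic_derivI[OF holL open_ball] that by auto
  define Q where "Q = (\<lambda>z. if z = 0 then deriv L 0 else L z / z)"
  have "Q holomorphic_on ball 0 1"
    using pole_lemma_open[OF holL open_ball, of 0] \<open>L 0 = 0\<close> by (simp add: Q_def cong: if_cong)
  then obtain A where A: "\<And>z. z \<in> ball 0 1 \<Longrightarrow> (A has_field_derivative Q z) (at z within ball 0 1)"
    using holomorphic_convex_primitive'[OF convex_ball open_ball] by blast
  have derA: "(A has_field_derivative Q z) (at z)" if "norm z < 1" for z
    using A[of z] that by (simp add: at_within_open[OF _ open_ball])
  have Q: "z * Q z = L z" for z using \<open>L 0 = 0\<close> by (simp add: Q_def)
  define r \<theta>1 where "r = norm z" and "\<theta>1 = Arg z"
  define c where "c = (\<lambda>\<theta>::real. of_real r * exp (\<i> * of_real \<theta>))"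
  have c1: "c \<theta>1 = z" using Arg_eq[of z] by (cases "z = 0") (auto simp: c_def r_def \<theta>1_def)
  have normc: "norm (c \<theta>) < 1" for \<theta> using z by (simp add: c_def r_def norm_mult)
  have derc: "(c has_vector_derivative (\<i> * c \<theta>)) (at \<theta>)" for \<theta>
    unfolding c_def by (rule has_vector_derivative_real_field) (auto intro!: derivative_eq_intros)
  define m where "m = Im (L z)"
  define \<psi> where "\<psi> = (\<lambda>\<theta>. Im (L (c \<theta>)) + \<theta>)"
  \<comment> \<open>\<open>C\<close> is an antiderivative of
    \<open>\<psi> \<theta> - \<psi> \<theta>1\<close>: the term \<open>- Re (A (c \<theta>))\<close>
    has derivative \<open>Im (L (c \<theta>))\<close>, and the quadratic supplies the rest.\<close>
  define C where "C = (\<lambda>\<theta>. - Re (A (c \<theta>)) + ((\<theta> - \<theta>1)\<^sup>2 / 2 - m * (\<theta> - \<theta>1)))"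
  have der\<psi>: "(\<psi> has_real_derivative (Re (c \<theta> * deriv L (c \<theta>)) + 1)) (at \<theta>)" for \<theta>
  proof -
    have "((\<lambda>\<theta>. L (c \<theta>)) has_vector_derivative (\<i> * c \<theta>) * deriv L (c \<theta>)) (at \<theta>)"
      using field_vector_diff_chain_at[OF derc derL[OF normc]] by (simp add: o_def)
    from bounded_linear.has_vector_derivative[OF bounded_linear_Im this]
    have "((\<lambda>\<theta>. Im (L (c \<theta>))) has_real_derivative Re (c \<theta> * deriv L (c \<theta>))) (at \<theta>)"
      by (simp add: has_real_derivative_iff_has_vector_derivative algebra_simps)
    then show ?thesis unfolding \<psi>_def by (rule DERIV_add[OF _ DERIV_ident])
  qed
  have derC: "(C has_real_derivative (\<psi> \<theta> - \<psi> \<theta>1)) (at \<theta>)" for \<theta>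
  proof -
    have "((\<lambda>\<theta>. A (c \<theta>)) has_vector_derivative (\<i> * c \<theta>) * Q (c \<theta>)) (at \<theta>)"
      using field_vector_diff_chain_at[OF derc derA[OF normc]] by (simp add: o_def)
    then have "((\<lambda>\<theta>. A (c \<theta>)) has_vector_derivative \<i> * L (c \<theta>)) (at \<theta>)"
      by (simp add: mult.assoc Q)
    from bounded_linear.has_vector_derivative[OF bounded_linear_Re this]
    have "((\<lambda>\<theta>. Re (A (c \<theta>))) has_real_derivative - Im (L (c \<theta>))) (at \<theta>)"
      by (simp add: has_real_derivative_iff_has_vector_derivative)
    moreover have "((\<lambda>\<theta>. (\<theta> - \<theta>1)\<^sup>2 / 2 - m * (\<theta> - \<theta>1)) has_real_derivative \<theta> - \<theta>1 - m) (at \<theta>)"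
      by (auto intro!: derivative_eq_intros)
    ultimately have "(C has_real_derivative - (- Im (L (c \<theta>))) + (\<theta> - \<theta>1 - m)) (at \<theta>)"
      unfolding C_def by (intro DERIV_add DERIV_minus)
    then show ?thesis by (simp add: \<psi>_def m_def c1 algebra_simps)
  qed
  have mono: "\<psi> a < \<psi> b" if "a < b" for a b
  proof (rule DERIV_pos_imp_increasing[OF that])
    show "\<exists>y. (\<psi> has_real_derivative y) (at \<theta>) \<and> 0 < y" for \<theta>
      using der\<psi>[of \<theta>] Re[OF normc, of \<theta>] by (intro exI[of _ "Re (c \<theta> * deriv L (c \<theta>)) + 1"]) simp
  qed
  have contC: "continuous_on S C" for S
    using derC by (meson DERIV_isCont continuous_at_imp_continuous_on)
  have percA: "c (\<theta> + 2 * pi) = c \<theta>" "c (\<theta> - 2 * pi) = c \<theta>" for \<theta>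
  proof -
    have "exp (\<i> * (2 * complex_of_real pi)) = 1" using exp_two_pi_i by (simp add: ac_simps)
    then show "c (\<theta> + 2 * pi) = c \<theta>" "c (\<theta> - 2 * pi) = c \<theta>"
      by (simp_all add: c_def distrib_left right_diff_distrib exp_add exp_diff)
  qed
  \<comment> \<open>As \<open>\<psi>\<close> increases, \<open>C\<close> has its minimum at
    \<open>\<theta>1\<close>. Over a full turn the periodic part of \<open>C\<close> cancels,
    leaving a bound on \<open>m\<close>: the turn forward gives \<open>m < pi\<close>, the turn
    backward \<open>- pi < m\<close>.\<close>
  have "C \<theta>1 < C (\<theta>1 + 2 * pi)"
    by (rule DERIV_pos_imp_increasing_open[OF _ _ contC]) (use derC mono in \<open>force+\<close>)
  then have "0 < (2 * pi)\<^sup>2 / 2 - m * (2 * pi)" unfolding C_def percA by simp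
  then have 1: "0 < (pi - m) * (2 * pi)"
    by (simp add: power2_eq_square left_diff_distrib)
  have "C (\<theta>1 - 2 * pi) > C \<theta>1"
    by (rule DERIV_neg_imp_decreasing_open[OF _ _ contC]) (use derC mono in \<open>force+\<close>)
  then have "0 < (2 * pi)\<^sup>2 / 2 + m * (2 * pi)" unfolding C_def percA by simp
  then have 2: "0 < (pi + m) * (2 * pi)"
    by (simp add: power2_eq_square distrib_right)
  show ?thesis using 1 2 by (simp add: m_def zero_less_mult_iff)
qed

text \<open>\<open>F\<close> is close-to-convex with respect to the convex function with derivative \<open>exp L\<close>.\<close>
lemma inj_on_close_to_convex_power:
  fixes \<mu> :: real
  assumes holL: "L holomorphic_on ball 0 1" and "L 0 = 0"
    and Re: "\<And>z. norm z < 1 \<Longrightarrow> Re (z * deriv L z) > - 1"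
    and derF: "\<And>z. norm z < 1 \<Longrightarrow> (F has_field_derivative exp (of_real \<mu> * L z)) (at z)"
    and \<mu>: "1 / 2 \<le> \<mu>" "\<mu> \<le> 3 / 2"
  shows "inj_on F (ball 0 1)"
proof (rule inj_on_unit_ball_if_smaller_balls)
  fix r :: real assume r: "0 < r" "r < 1"
  have derL: "(L has_field_derivative deriv L z) (at z)" if "norm z < 1" for z
    using holomorphic_derivI[OF holL open_ball] that by auto
  \<comment> \<open>After division by \<open>exp (L z)\<close>, the derivative of the chain is
    \<open>q1 z + k t * q2 z\<close>. Both have positive real part: \<open>q2\<close> by the
    hypothesis on \<open>L\<close>, and \<open>q1\<close> because its argument is below pi / 2 in
    modulus.\<close>
  define q1 q2 where "q1 = (\<lambda>z. exp (of_real (\<mu> - 1) * L z))" and "q2 = (\<lambda>z. 1 + z * deriv L z)"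
  have sub: "cball 0 r \<subseteq> ball (0::complex) 1" using r by auto
  have "continuous_on (ball 0 1) q1" "continuous_on (ball 0 1) q2"
    unfolding q1_def q2_def
    by (intro holomorphic_on_imp_continuous_on holomorphic_intros holL holomorphic_deriv open_ball)+
  then have cont: "continuous_on (cball 0 r) q1" "continuous_on (cball 0 r) q2"
    using sub continuous_on_subset by blast+
  have pos: "Re (q1 z) > 0" "Re (q2 z) > 0" if "norm z < 1" for z
  proof -
    have "\<bar>(\<mu> - 1) * Im (L z)\<bar> < pi / 2"
    proof -
      have "\<bar>\<mu> - 1\<bar> * \<bar>Im (L z)\<bar> \<le> 1 / 2 * \<bar>Im (L z)\<bar>" using \<mu> by (intro mult_right_mono abs_leI) auto
      then show ?thesis
        using abs_Im_log_convex_derivative_less_pi[OF holL \<open>L 0 = 0\<close> Re that] by (simp add: abs_mult)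
    qed
    then have "cos ((\<mu> - 1) * Im (L z)) > 0" by (intro cos_gt_zero_pi) auto
    then show "Re (q1 z) > 0" by (simp add: q1_def Re_exp)
    show "Re (q2 z) > 0" using Re[OF that] by (simp add: q2_def)
  qed
  have "\<exists>\<delta>>0. \<forall>z\<in>cball 0 r. \<delta> \<le> Re (q z)"
    if "continuous_on (cball 0 r) q" "\<And>z. norm z < 1 \<Longrightarrow> Re (q z) > 0" for q :: "complex \<Rightarrow> complex"
  proof -
    have contq: "continuous_on (cball 0 r) (\<lambda>z. Re (q z))" using that(1) by (intro continuous_intros)
    then obtain z0 where "z0 \<in> cball 0 r" "\<And>z. z \<in> cball 0 r \<Longrightarrow> Re (q z0) \<le> Re (q z)"
      using continuous_attains_inf[OF compact_cball _ contq] r by auto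
    then show ?thesis using that(2)[of z0] r by (intro exI[of _ "Re (q z0)"]) auto
  qed
  from this[OF cont(1) pos(1)] this[OF cont(2) pos(2)]
  obtain d1 d2 where d: "d1 > 0" "d2 > 0" "\<And>z. z \<in> cball 0 r \<Longrightarrow> d1 \<le> Re (q1 z)" "\<And>z. z \<in> cball 0 r \<Longrightarrow> d2 \<le> Re (q2 z)"
    by blast
  define \<delta> where "\<delta> = min d1 d2"
  have \<delta>: "\<delta> > 0" "\<And>z. z \<in> cball 0 r \<Longrightarrow> \<delta> \<le> Re (q1 z)" "\<And>z. z \<in> cball 0 r \<Longrightarrow> \<delta> \<le> Re (q2 z)"
    using d by (auto simp: \<delta>_def min_le_iff_disj)
  have "bounded (q1 ` cball 0 r)" "bounded (q2 ` cball 0 r)"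
    using compact_imp_bounded[OF compact_continuous_image[OF _ compact_cball]] cont by blast+
  then obtain C1 C2 where C12: "\<And>z. z \<in> cball 0 r \<Longrightarrow> norm (q1 z) \<le> C1" "\<And>z. z \<in> cball 0 r \<Longrightarrow> norm (q2 z) \<le> C2"
    unfolding bounded_iff by blast
  define C where "C = max C1 C2"
  have C: "norm (q1 z) \<le> C" "norm (q2 z) \<le> C" if "z \<in> cball 0 r" for z
    using C12[OF that] by (auto simp: C_def)
  \<comment> \<open>\<open>M\<close> is so large that every convex combination q of
    \<open>q1 z\<close> and \<open>q2 z\<close> satisfies |q|^2 <= C^2 < M \<delta> <= M Re q. With
    weight \<open>s = exp (- (M * t))\<close> on \<open>q1\<close>, the expansion quotient is M /
    q.\<close>
  define M where "M = C\<^sup>2 / \<delta> + 1"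
  have M: "M > 0" "C\<^sup>2 < M * \<delta>" using \<delta>(1) by (auto simp: M_def field_simps add_pos_nonneg)
  define k where "k = (\<lambda>t. complex_of_real (exp (M * t) - 1))"
  define k' where "k' = (\<lambda>t. complex_of_real (M * exp (M * t)))"
  show "inj_on F (ball 0 r)"
  proof (rule inj_on_of_radial_chain[OF r derF, where k = k and k' = k'
        and G = "\<lambda>z. exp (L z)" and G' = "\<lambda>z. exp (L z) * deriv L z"])
    show "((\<lambda>z. exp (L z)) has_field_derivative exp (L z) * deriv L z) (at z)"
      if "norm z < 1" for z
      using derL[OF that] by (auto intro!: derivative_eq_intros)
    show "k 0 = 0" by (simp add: k_def)
    show "(k has_vector_derivative k' t) (at t)" for t
    proof -
      have "((\<lambda>t. exp (M * t) - 1) has_real_derivative M * exp (M * t)) (at t)"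
        by (auto intro!: derivative_eq_intros)
      from has_vector_derivative_of_real[OF this, where 'a = complex]
      show ?thesis unfolding k_def k'_def .
    qed
    show "filterlim (\<lambda>t. norm (k t)) at_top at_top"
    proof (rule filterlim_at_top_mono)
      show "filterlim (\<lambda>t. t * M) at_top at_top"
        using M by (intro filterlim_at_top_mult_tendsto_pos[OF tendsto_const _ filterlim_ident]) auto
      show "\<forall>\<^sub>F t in at_top. t * M \<le> norm (k t)"
      proof (rule always_eventually, rule allI)
        fix t
        have "t * M \<le> exp (M * t) - 1" using exp_ge_add_one_self[of "M * t"] unfolding mult.commute[of t M] by linarith
        also have "\<dots> \<le> norm (k t)" unfolding k_def norm_of_real by (rule abs_ge_self)
        finally show "t * M \<le> norm (k t)" .
      qed
    qed
    show "1 < Re (k' t * exp (L z) / (exp (of_real \<mu> * L z) + k t * (exp (L z) + z * (exp (L z) * deriv L z))))"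
      if t: "0 < t" and z: "norm z \<le> r * exp (- t)" for t z
    proof -
      have "r * exp (- t) \<le> r * 1" using r t by (intro mult_left_mono) auto
      then have zr: "z \<in> cball 0 r" using z by simp
      define s where "s = exp (- (M * t))"
      have s: "0 < s" "s < 1" and es: "exp (M * t) = 1 / s"
        using t M by (auto simp: s_def exp_minus field_simps)
      define q where "q = of_real s * q1 z + of_real (1 - s) * q2 z"
      have "\<delta> = s * \<delta> + (1 - s) * \<delta>" by (simp add: algebra_simps)
      also have "\<dots> \<le> Re q"
        unfolding q_def using s \<delta>(2,3)[OF zr] by (simp add: add_mono mult_left_mono)
      finally have "\<delta> \<le> Re q" .
      have "norm q \<le> s * norm (q1 z) + (1 - s) * norm (q2 z)"
        unfolding q_def using s by (intro order_trans[OF norm_triangle_ineq]) (simp add: norm_mult del: of_real_diff)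
      also have "\<dots> \<le> s * C + (1 - s) * C"
        using s C[OF zr] by (intro add_mono mult_left_mono) auto
      finally have "norm q \<le> C" by (simp add: algebra_simps)
      then have "(norm q)\<^sup>2 \<le> C\<^sup>2" by (intro power_mono) auto
      also have "\<dots> < M * \<delta>" by (rule M)
      also have "\<dots> \<le> M * Re q" using \<open>\<delta> \<le> Re q\<close> M by simp
      finally have gt: "Re (of_real M / q) > 1" by (rule Re_of_real_divide_gt_one)
      have "exp (of_real \<mu> * L z) = q1 z * exp (L z)"
        by (simp add: q1_def algebra_simps flip: exp_add)
      then have "exp (of_real \<mu> * L z) + k t * (exp (L z) + z * (exp (L z) * deriv L z))
          = (q1 z + k t * q2 z) * exp (L z)" by (simp add: q2_def algebra_simps)
      also have "q1 z + k t * q2 z = q / of_real s"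
        using s unfolding k_def es q_def by (simp add: field_simps)
      finally have "k' t * exp (L z) / (exp (of_real \<mu> * L z) + k t * (exp (L z) + z * (exp (L z) * deriv L z)))
          = k' t / (q / of_real s)" by simp
      also have "\<dots> = of_real M / q" using s unfolding k'_def es by simp
      finally show ?thesis using gt by simp
    qed
  qed auto
qed

section \<open>The Alexander transform and the logarithm attached to a spirallike function\<close>

lemma alexander_has_field_derivative:
  assumes hol: "f holomorphic_on ball 0 1" and "f 0 = 0" and z: "norm z < 1"
  shows "(alexander f has_field_derivative (if z = 0 then deriv f 0 else f z / z)) (at z)"
proof -
  define Q where "Q = (\<lambda>z. if z = 0 then deriv f 0 else f z / z)"
  have "Q holomorphic_on ball 0 1"
    using pole_lemma_open[OF hol open_ball, of 0] \<open>f 0 = 0\<close> by (simp add: Q_def cong: if_cong)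
  then obtain A where A: "\<And>z. z \<in> ball 0 1 \<Longrightarrow> (A has_field_derivative Q z) (at z within ball 0 1)"
    using holomorphic_convex_primitive'[OF convex_ball open_ball] by blast
  have eq: "alexander f w = A w - A 0" if "w \<in> ball 0 1" for w
  proof -
    have "alexander f w = integral {0..1} (\<lambda>x. f (linepath 0 w x) / linepath 0 w x * w)"
      by (simp add: alexander_def contour_integral_integral)
    \<comment> \<open>At the origin \<open>f w / w\<close> evaluates to 0 instead of the removable
      value \<open>deriv f 0\<close>. For \<open>w\<close> nonzero this affects the single parameter
      0; for \<open>w = 0\<close> the factor \<open>w\<close> kills both integrands.\<close>
    also have "\<dots> = integral {0..1} (\<lambda>x. Q (linepath 0 w x) * w)"
      by (rule integral_spike[of "{0}"]) (auto simp: Q_def linepath_def)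
    also have "\<dots> = contour_integral (linepath 0 w) Q"
      by (simp add: contour_integral_integral)
    also have "\<dots> = A w - A 0"
    proof (rule contour_integral_unique)
      have "closed_segment 0 w \<subseteq> ball 0 1"
        using that by (intro closed_segment_subset) auto
      then show "(Q has_contour_integral A w - A 0) (linepath 0 w)"
        using contour_integral_primitive[OF A, of "linepath 0 w"] by auto
    qed
    finally show ?thesis .
  qed
  have "((\<lambda>w. A w - A 0) has_field_derivative Q z) (at z)"
    using A[of z] z by (auto simp: at_within_open[OF _ open_ball] intro!: derivative_eq_intros)
  then have "(alexander f has_field_derivative Q z) (at z)"
    by (rule has_field_derivative_transform_within_open[OF _ open_ball[of 0 1]]) (use z eq in auto)
  then show ?thesis by (simp add: Q_def)
qed

lemma alexander_zero: "alexander f 0 = 0"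
  by (simp add: alexander_def)

text \<open>Dividing the logarithm of f(z) / z by \<mu> rotates the spirallike condition into a half
  plane: since exp (i \<alpha>) \<mu> is the real number (1 - lam) cos \<alpha>, the quantity exp (i
  \<alpha>) z f'/f equals exp (i \<alpha>) + (1 - lam) cos \<alpha> z L'.\<close>

lemma alexander_spirallike_logarithm:
  assumes f: "f \<in> spirallike \<alpha> lam" and "lam < 1" and "cos \<alpha> > 0"
  obtains L where "L holomorphic_on ball 0 1" "L 0 = 0"
    "\<And>z. norm z < 1 \<Longrightarrow> Re (z * deriv L z) > - 1"
    "\<And>z. norm z < 1 \<Longrightarrow> (alexander f has_field_derivative
        exp (of_real ((1 - lam) * cos \<alpha>) * exp (- (\<i> * of_real \<alpha>)) * L z)) (at z)"
proof -
  have hol: "f holomorphic_on ball 0 1" and f0: "f 0 = 0" and f'0: "deriv f 0 = 1"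
    and nz: "\<And>z. norm z < 1 \<Longrightarrow> z \<noteq> 0 \<Longrightarrow> f z \<noteq> 0"
    and spiral: "\<And>z. norm z < 1 \<Longrightarrow> z \<noteq> 0 \<Longrightarrow> Re (exp (\<i> * of_real \<alpha>) * z * deriv f z / f z) > lam * cos \<alpha>"
    using f by (auto simp: spirallike_def classA_def unit_disk_def)
  define \<kappa> where "\<kappa> = (1 - lam) * cos \<alpha>"
  define \<mu> where "\<mu> = of_real \<kappa> * exp (- (\<i> * of_real \<alpha>))"
  have "\<kappa> > 0" using assms by (simp add: \<kappa>_def)
  then have "\<mu> \<noteq> 0" by (simp add: \<mu>_def)
  define Q where "Q = (\<lambda>z. if z = 0 then deriv f 0 else f z / z)"
  have holQ: "Q holomorphic_on ball 0 1"
    using pole_lemma_open[OF hol open_ball, of 0] f0 by (simp add: Q_def cong: if_cong)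
  have Q0: "Q z \<noteq> 0" if "z \<in> ball 0 1" for z
    using that nz f'0 by (auto simp: Q_def)
  obtain \<Lambda> where \<Lambda>: "\<Lambda> holomorphic_on ball 0 1" "\<And>z. z \<in> ball 0 1 \<Longrightarrow> exp (\<Lambda> z) = Q z"
    using holomorphic_logarithm_exists[OF convex_ball open_ball holQ Q0 centre_in_ball[THEN iffD2]] zero_less_one
    by blast
  \<comment> \<open>Subtracting \<open>\<Lambda> 0\<close> normalises \<open>L 0 = 0\<close> without
    changing the exponential, because \<open>exp (\<Lambda> 0) = deriv f 0 = 1\<close>.\<close>
  define L where "L = (\<lambda>z. (\<Lambda> z - \<Lambda> 0) / \<mu>)"
  have holL: "L holomorphic_on ball 0 1"
    unfolding L_def using \<Lambda>(1) \<open>\<mu> \<noteq> 0\<close> by (intro holomorphic_intros) auto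
  have Q: "exp (\<mu> * L z) = Q z" if "norm z < 1" for z
    using that \<Lambda>(2)[of z] \<Lambda>(2)[of 0] f'0 \<open>\<mu> \<noteq> 0\<close> by (simp add: L_def exp_diff Q_def)
  have Re: "Re (z * deriv L z) > - 1" if z: "norm z < 1" for z
  proof (cases "z = 0")
    case False
    have "(L has_field_derivative deriv L z) (at z)"
      using holomorphic_derivI[OF holL open_ball] z by auto
    then have "((\<lambda>z. z * exp (\<mu> * L z)) has_field_derivative exp (\<mu> * L z) * (1 + \<mu> * (z * deriv L z))) (at z)"
      by (auto intro!: derivative_eq_intros simp: algebra_simps)
    then have "(f has_field_derivative exp (\<mu> * L z) * (1 + \<mu> * (z * deriv L z))) (at z)"
      by (rule has_field_derivative_transform_within_open[OF _ open_ball[of 0 1]])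
         (use z Q f0 in \<open>auto simp: Q_def\<close>)
    then have "deriv f z = exp (\<mu> * L z) * (1 + \<mu> * (z * deriv L z))" by (rule DERIV_imp_deriv)
    moreover have "f z = z * exp (\<mu> * L z)" using Q[OF z] False by (simp add: Q_def)
    ultimately have "exp (\<i> * of_real \<alpha>) * z * deriv f z / f z = exp (\<i> * of_real \<alpha>) * (1 + \<mu> * (z * deriv L z))"
      using False by simp
    also have "\<dots> = exp (\<i> * of_real \<alpha>) + of_real \<kappa> * (z * deriv L z)"
      by (simp add: \<mu>_def exp_minus algebra_simps)
    finally have "lam * cos \<alpha> < Re (exp (\<i> * of_real \<alpha>) + of_real \<kappa> * (z * deriv L z))"
      using spiral[OF z False] by simp
    also have "\<dots> = cos \<alpha> + \<kappa> * Re (z * deriv L z)"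
      by (simp add: Re_exp)
    finally have "0 < \<kappa> * (1 + Re (z * deriv L z))"
      by (simp add: \<kappa>_def algebra_simps)
    then show ?thesis using \<open>\<kappa> > 0\<close> by (simp add: zero_less_mult_iff)
  qed simp
  show ?thesis
  proof (rule that[OF holL _ Re])
    show "L 0 = 0" by (simp add: L_def)
    show "(alexander f has_field_derivative exp (of_real ((1 - lam) * cos \<alpha>) * exp (- (\<i> * of_real \<alpha>)) * L z)) (at z)"
      if "norm z < 1" for z
      using alexander_has_field_derivative[OF hol f0 that] Q[OF that] by (simp add: Q_def \<mu>_def \<kappa>_def)
  qed
qed

lemma alexander_in_classA:
  assumes "f \<in> classA" shows "alexander f \<in> classA"
proof -
  have f: "f holomorphic_on ball 0 1" "f 0 = 0" "deriv f 0 = 1"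
    using assms by (auto simp: classA_def unit_disk_def)
  note der = alexander_has_field_derivative[OF f(1,2)]
  have "alexander f holomorphic_on ball 0 1"
    unfolding holomorphic_on_open[OF open_ball] using der mem_ball_0 by blast
  moreover have "deriv (alexander f) 0 = 1"
    using DERIV_imp_deriv[OF der[of 0]] f(3) by simp
  ultimately show ?thesis by (simp add: classA_def unit_disk_def alexander_zero)
qed

section \<open>Counterexamples from complex powers of 1 - z\<close>

text \<open>\<open>z \<mapsto> Ln (1 - z)\<close> maps the disk onto a domain that is asymptotic to the strip \<open>\<bar>Im u\<bar> < \<pi> / 2\<close>
  as \<open>Re u \<rightarrow> - \<infinity>\<close>, and there \<open>exp (c u)\<close> has the period \<open>2 \<pi> \<i> / c\<close>.\<close>
lemma power_of_one_minus_not_injective: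
  fixes c :: complex
  assumes "2 * \<bar>Re c\<bar> < (norm c)\<^sup>2"
  shows "\<exists>x y. norm x < 1 \<and> norm y < 1 \<and> x \<noteq> y \<and> exp (c * Ln (1 - x)) = exp (c * Ln (1 - y))"
proof -
  have "c \<noteq> 0" using assms by auto
  \<comment> \<open>\<open>v\<close> is a period of exp (c u), and the hypothesis on
    \<open>c\<close> says precisely that its imaginary part is below pi in modulus. Two points
    differing by \<open>v\<close> then fit into the strip.\<close>
  define v where "v = 2 * of_real pi * \<i> / c"
  have "v \<noteq> 0" using \<open>c \<noteq> 0\<close> by (simp add: v_def)
  have "Im v = 2 * pi * Re c / (norm c)\<^sup>2"
    by (simp add: v_def Im_divide cmod_power2)
  then have "\<bar>Im v\<bar> = pi * (2 * \<bar>Re c\<bar> / (norm c)\<^sup>2)" by (simp add: abs_mult)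
  also have "\<dots> < pi * 1"
    using assms \<open>c \<noteq> 0\<close> by (intro mult_strict_left_mono) (simp_all add: divide_less_eq_1_pos)
  finally have Imv: "\<bar>Im v\<bar> < pi" by simp
  have pos: "2 * cos (Im v / 2) > 0" using Imv by (simp add: cos_gt_zero_pi)
  \<comment> \<open>A point exp u lies in the disk of radius 1 about 1 iff exp (Re u) < 2 cos (Im
    u). The shift \<open>a\<close> moves both points \<open>a + v / 2\<close> and
    \<open>a - v / 2\<close> far enough to the left; the final - 1 makes the inequality
    strict.\<close>
  define a where "a = ln (2 * cos (Im v / 2)) - \<bar>Re v\<bar> / 2 - 1"
  have disk: "norm (1 - exp u) < 1" and Ln: "Ln (exp u) = u"
    if u: "u = of_real a + v / 2 \<or> u = of_real a - v / 2" for u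
  proof -
    have "Re u < ln (2 * cos (Im v / 2))" using u by (auto simp: a_def)
    then have "exp (Re u) < 2 * cos (Im v / 2)" using pos by (metis exp_less_cancel_iff exp_ln)
    moreover have "cos (Im u) = cos (Im v / 2)" using u by auto
    ultimately have "exp (Re u) * exp (Re u) < exp (Re u) * (2 * cos (Im u))" by simp
    moreover have "(norm (1 - exp u))\<^sup>2 = 1 - exp (Re u) * (2 * cos (Im u)) + exp (Re u) * exp (Re u) * ((cos (Im u))\<^sup>2 + (sin (Im u))\<^sup>2)"
    proof -
      have "(norm (1 - exp u))\<^sup>2 = (1 - exp (Re u) * cos (Im u))\<^sup>2 + (exp (Re u) * sin (Im u))\<^sup>2"
        unfolding cmod_power2 by (simp add: Re_exp Im_exp)
      then show ?thesis by algebra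
    qed
    ultimately have "(norm (1 - exp u))\<^sup>2 < 1\<^sup>2" by simp
    then show "norm (1 - exp u) < 1" by (rule power2_less_imp_less) simp
    show "Ln (exp u) = u" using u Imv by (intro Ln_exp) auto
  qed
  define x y where "x = 1 - exp (of_real a + v / 2)" and "y = 1 - exp (of_real a - v / 2)"
  have Lnxy: "Ln (1 - x) = of_real a + v / 2" "Ln (1 - y) = of_real a - v / 2"
    using Ln by (simp_all add: x_def y_def)
  have "x \<noteq> y"
  proof
    assume "x = y"
    then have "of_real a + v / 2 = of_real a - v / 2" using Lnxy by metis
    then show False using \<open>v \<noteq> 0\<close> by (simp add: field_simps)
  qed
  moreover have "exp (c * Ln (1 - x)) = exp (c * Ln (1 - y))"
  proof -
    have "c * Ln (1 - x) = c * Ln (1 - y) + 2 * of_real pi * \<i>"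
      unfolding Lnxy using \<open>c \<noteq> 0\<close> by (simp add: v_def field_simps)
    then show ?thesis by (simp add: exp_add exp_two_pi_i)
  qed
  moreover have "norm x < 1" "norm y < 1" using disk by (simp_all add: x_def y_def)
  ultimately show ?thesis by blast
qed

lemma Re_divide_one_minus_gt:
  fixes z :: complex assumes "norm z < 1"
  shows "Re (z / (1 - z)) > - 1 / 2"
proof -
  have "1 - z \<noteq> 0" using assms by auto
  have "(norm z)\<^sup>2 < 1" using assms by (simp add: power_less_one_iff)
  then have "(norm (1 - z))\<^sup>2 < 2 * Re (1 - z)"
    unfolding cmod_power2 by (simp add: power2_eq_square algebra_simps)
  from Re_of_real_divide_gt_one[OF this] have "1 < Re (2 / (1 - z))" by simp
  moreover have "z / (1 - z) = (2 / (1 - z)) / 2 - 1" using \<open>1 - z \<noteq> 0\<close> by (simp add: field_simps)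
  then have "Re (z / (1 - z)) = Re (2 / (1 - z)) / 2 - 1" by (simp only: minus_complex.sel Re_divide_numeral) simp
  ultimately show ?thesis by simp
qed

lemma exists_spirallike_alexander_not_univalent:
  assumes "cos \<alpha> < 1" and m: "(1 - lam) * cos \<alpha> > 1 / 2"
  shows "\<exists>f\<in>spirallike \<alpha> lam. alexander f \<notin> classS"
proof -
  \<comment> \<open>The first entry of the minimum keeps \<open>f\<close> in the class, the second
    keeps c outside the disk |c + 1| <= 1; \<open>s > 1 / 2\<close> keeps it outside |c - 1| <=
    1.\<close>
  define s where "s = 1 / 2 + min ((1 - lam) * cos \<alpha> - 1 / 2) (1 - cos \<alpha>)"
  have s: "s > 1 / 2" "s \<le> (1 - lam) * cos \<alpha>" "s - 1 / 2 \<le> 1 - cos \<alpha>"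
    using assms by (auto simp: s_def)
  define \<nu> where "\<nu> = of_real s * exp (- (\<i> * of_real \<alpha>))"
  define c where "c = 1 - 2 * \<nu>"
  define g where "g = (\<lambda>z. exp (- 2 * \<nu> * Ln (1 - z)))"
  define f where "f = (\<lambda>z. z * g z)"
  have re: "1 - z \<notin> \<real>\<^sub>\<le>\<^sub>0" "1 - z \<noteq> 0" if "norm z < 1" for z :: complex
  proof -
    have "Re z < 1" using that complex_Re_le_cmod[of z] by linarith
    then show "1 - z \<notin> \<real>\<^sub>\<le>\<^sub>0" "1 - z \<noteq> 0" by (auto simp: complex_nonpos_Reals_iff)
  qed
  have derg: "(g has_field_derivative g z * (2 * \<nu> / (1 - z))) (at z)" if "norm z < 1" for z
    unfolding g_def using re[OF that] by (auto intro!: derivative_eq_intros simp: field_simps)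
  have derf: "(f has_field_derivative g z * (1 + 2 * \<nu> * (z / (1 - z)))) (at z)" if "norm z < 1" for z
    unfolding f_def using derg[OF that] by (auto intro!: derivative_eq_intros simp: field_simps)
  have g0: "g z \<noteq> 0" for z by (simp add: g_def)
  have holf: "f holomorphic_on ball 0 1"
    unfolding holomorphic_on_open[OF open_ball] using derf mem_ball_0 by blast
  have f'0: "deriv f 0 = 1" using DERIV_imp_deriv[OF derf[of 0]] by (simp add: g_def)
  have f: "f \<in> spirallike \<alpha> lam"
    unfolding spirallike_def classA_def unit_disk_def
  proof (intro CollectI conjI ballI impI holf f'0)
    show "f 0 = 0" by (simp add: f_def)
    fix z :: complex assume z: "z \<in> ball 0 1" "z \<noteq> 0"
    show "f z \<noteq> 0" using z g0 by (simp add: f_def)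
    have z1: "norm z < 1" using z by simp
    have "exp (\<i> * of_real \<alpha>) * z * deriv f z / f z = exp (\<i> * of_real \<alpha>) * (1 + 2 * \<nu> * (z / (1 - z)))"
      using DERIV_imp_deriv[OF derf[OF z1]] z g0[of z] by (simp add: f_def)
    also have "\<dots> = exp (\<i> * of_real \<alpha>) + of_real (2 * s) * (z / (1 - z))"
      by (simp add: \<nu>_def exp_minus distrib_left)
    also have "Re (exp (\<i> * of_real \<alpha>) + of_real (2 * s) * w) = cos \<alpha> + 2 * s * Re w" for w
      by (simp add: Re_exp)
    finally have eq: "Re (exp (\<i> * of_real \<alpha>) * z * deriv f z / f z) = cos \<alpha> + 2 * s * Re (z / (1 - z))" .
    have "lam * cos \<alpha> \<le> cos \<alpha> + 2 * s * (- 1 / 2)" using s by (simp add: algebra_simps)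
    also have "\<dots> < cos \<alpha> + 2 * s * Re (z / (1 - z))"
      using s Re_divide_one_minus_gt[OF z1] by (intro add_strict_left_mono mult_strict_left_mono) auto
    finally show "lam * cos \<alpha> < Re (exp (\<i> * of_real \<alpha>) * z * deriv f z / f z)" using eq by simp
  qed
  have "2 * \<bar>Re c\<bar> < (norm c)\<^sup>2"
  proof -
    have Rec: "Re c = 1 - 2 * s * cos \<alpha>" and Imc: "Im c = 2 * s * sin \<alpha>"
      by (simp_all add: c_def \<nu>_def Re_exp Im_exp)
    have "(norm c)\<^sup>2 = 1 - 4 * s * cos \<alpha> + 4 * s\<^sup>2 * ((cos \<alpha>)\<^sup>2 + (sin \<alpha>)\<^sup>2)"
      unfolding cmod_power2 Rec Imc by algebra
    then have n: "(norm c)\<^sup>2 = 1 - 4 * s * cos \<alpha> + 4 * s\<^sup>2" by simp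
    have "s\<^sup>2 > (1 / 2)\<^sup>2" using s(1) by (intro power_strict_mono) auto
    then have 1: "2 * Re c < (norm c)\<^sup>2" unfolding n Rec by (simp add: power2_eq_square)
    define e where "e = s - 1 / 2"
    have e: "e > 0" "e \<le> 1 - cos \<alpha>" "s = 1 / 2 + e" using s by (auto simp: e_def)
    \<comment> \<open>This expression is \<open>(norm c)\<^sup>2 + 2 * Re c\<close> rewritten with
      \<open>s = 1 / 2 + e\<close>.\<close>
    have "0 < 4 * (1 - cos \<alpha> - e) + 8 * (e * (1 - cos \<alpha>)) + 4 * e\<^sup>2"
      using e assms(1) by (intro add_nonneg_pos add_nonneg_nonneg) auto
    then have "- 2 * Re c < (norm c)\<^sup>2"
      unfolding n Rec e(3) by (simp add: power2_eq_square algebra_simps)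
    with 1 show ?thesis by linarith
  qed
  then obtain x y where xy: "norm x < 1" "norm y < 1" "x \<noteq> y" "exp (c * Ln (1 - x)) = exp (c * Ln (1 - y))"
    and "c \<noteq> 0"
    using power_of_one_minus_not_injective[of c] by fastforce
  \<comment> \<open>\<open>\<Phi>\<close> has the same derivative \<open>g\<close> as the transform,
    so they differ by a constant and share the collision at \<open>x\<close>,
    \<open>y\<close>.\<close>
  define \<Phi> where "\<Phi> = (\<lambda>z. - exp (c * Ln (1 - z)) / c)"
  have der: "((\<lambda>z. alexander f z - \<Phi> z) has_field_derivative 0) (at z within ball 0 1)" if "z \<in> ball 0 1" for z
  proof (rule has_field_derivative_at_within)
    have z: "norm z < 1" using that by simp
    have "exp (c * Ln (1 - z)) = g z * (1 - z)"
      using re[OF z] by (simp add: c_def g_def left_diff_distrib exp_diff exp_minus field_simps)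
    moreover have "(\<Phi> has_field_derivative exp (c * Ln (1 - z)) / (1 - z)) (at z)"
      unfolding \<Phi>_def using re[OF z] \<open>c \<noteq> 0\<close> by (auto intro!: derivative_eq_intros simp: divide_simps)
    ultimately have "(\<Phi> has_field_derivative g z) (at z)" using re[OF z] by simp
    moreover have "(alexander f has_field_derivative g z) (at z)"
      using alexander_has_field_derivative[OF holf _ z] f'0 by (cases "z = 0") (auto simp: f_def g_def)
    ultimately show "((\<lambda>z. alexander f z - \<Phi> z) has_field_derivative 0) (at z)"
      using DERIV_diff by fastforce
  qed
  obtain C where "\<And>z. z \<in> ball 0 1 \<Longrightarrow> alexander f z - \<Phi> z = C"
    using has_field_derivative_zero_constant[OF convex_ball der] by blast
  then have "alexander f x - \<Phi> x = alexander f y - \<Phi> y" using xy by simp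
  then have "alexander f x = alexander f y" using xy(4) by (simp add: \<Phi>_def)
  then have "alexander f \<notin> classS"
    using xy mem_ball_0 unfolding classS_def unit_disk_def inj_on_def by blast
  then show ?thesis using f by blast
qed

section \<open>Combining the criteria with the counterexamples\<close>

theorem theorem2p5:
  fixes lam :: real
  assumes "lam < 1"
  shows "(\<forall>\<alpha>::real. - (pi/2) < \<alpha> \<and> \<alpha> < pi/2 \<and> \<alpha> \<noteq> 0 \<longrightarrow>
            ((\<forall>f\<in>spirallike \<alpha> lam. alexander f \<in> classS) \<longleftrightarrow> cos \<alpha> \<le> 1 / (2 * (1 - lam))))
       \<and> (- 1/2 \<le> lam \<longrightarrow> (\<forall>f\<in>spirallike 0 lam. alexander f \<in> classS))"
proof (intro conjI allI impI iffI)
  fix \<alpha> :: real assume \<alpha>: "- (pi/2) < \<alpha> \<and> \<alpha> < pi/2 \<and> \<alpha> \<noteq> 0"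
  have "cos \<alpha> > 0" using \<alpha> by (intro cos_gt_zero_pi) auto
  have "sin \<alpha> \<noteq> 0" using \<alpha> sin_eq_0_pi[of \<alpha>] pi_gt_zero by auto
  have "cos \<alpha> < 1"
    using \<open>sin \<alpha> \<noteq> 0\<close> cos_one_sin_zero[of \<alpha>] cos_le_one[of \<alpha>] by (meson order_less_le)
  have iff: "cos \<alpha> \<le> 1 / (2 * (1 - lam)) \<longleftrightarrow> (1 - lam) * cos \<alpha> \<le> 1 / 2"
    using assms by (simp add: field_simps)
  {
    assume "\<forall>f\<in>spirallike \<alpha> lam. alexander f \<in> classS"
    then show "cos \<alpha> \<le> 1 / (2 * (1 - lam))"
      using exists_spirallike_alexander_not_univalent[OF \<open>cos \<alpha> < 1\<close>, of lam] iff by force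
  next
    assume le: "cos \<alpha> \<le> 1 / (2 * (1 - lam))"
    show "\<forall>f\<in>spirallike \<alpha> lam. alexander f \<in> classS"
    proof
      fix f assume f: "f \<in> spirallike \<alpha> lam"
      define \<mu> where "\<mu> = of_real ((1 - lam) * cos \<alpha>) * exp (- (\<i> * of_real \<alpha>))"
      have "norm \<mu> = (1 - lam) * cos \<alpha>"
        using assms \<open>cos \<alpha> > 0\<close> unfolding \<mu>_def norm_mult norm_of_real by simp
      then have "norm \<mu> \<le> 1 / 2" using le iff by simp
      \<comment> \<open>The bound on the norm admits the excluded value 1 / 2; a nonzero imaginary
        part, due to \<alpha> \<noteq> 0, rules it out.\<close>
      moreover have "Im \<mu> = - ((1 - lam) * cos \<alpha> * sin \<alpha>)"
        by (simp add: \<mu>_def Re_exp Im_exp)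
      then have "Im \<mu> \<noteq> Im (1 / 2)" using assms \<open>cos \<alpha> > 0\<close> \<open>sin \<alpha> \<noteq> 0\<close> by simp
      then have "\<mu> \<noteq> 1 / 2" by metis
      ultimately have "inj_on (alexander f) (ball 0 1)"
        using alexander_spirallike_logarithm[OF f assms \<open>cos \<alpha> > 0\<close>]
          inj_on_small_power_of_convex_derivative unfolding \<mu>_def by metis
      then show "alexander f \<in> classS"
        using f alexander_in_classA by (simp add: classS_def spirallike_def unit_disk_def)
    qed
  }
next
  assume lam: "- 1 / 2 \<le> lam"
  show "\<forall>f\<in>spirallike 0 lam. alexander f \<in> classS"
  proof
    fix f assume f: "f \<in> spirallike 0 lam"
    obtain L where L: "L holomorphic_on ball 0 1" "L 0 = 0"
        "\<And>z. norm z < 1 \<Longrightarrow> Re (z * deriv L z) > - 1"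
      and derF: "\<And>z. norm z < 1 \<Longrightarrow> (alexander f has_field_derivative exp (of_real (1 - lam) * L z)) (at z)"
      using alexander_spirallike_logarithm[OF f assms] by auto
    have "inj_on (alexander f) (ball 0 1)"
    \<comment> \<open>Here \<mu> = 1 - lam is real and at most 3 / 2. The small-power criterion
      covers values below 1 / 2, and the close-to-convex one covers 1 / 2 to 3 / 2, including the
      endpoint that the former excludes.\<close>
    proof (cases "1 - lam < 1 / 2")
      case True
      have n: "norm (complex_of_real (1 - lam)) = 1 - lam" using assms by (simp only: norm_of_real)
      have "norm (complex_of_real (1 - lam)) \<noteq> norm (1 / 2 :: complex)" using True unfolding n by simp
      then have "complex_of_real (1 - lam) \<noteq> 1 / 2" by metis
      with True n show ?thesis
        by (intro inj_on_small_power_of_convex_derivative[OF L derF]) auto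
    next
      case False
      then show ?thesis using lam by (intro inj_on_close_to_convex_power[OF L derF]) auto
    qed
    then show "alexander f \<in> classS"
      using f alexander_in_classA by (simp add: classS_def spirallike_def unit_disk_def)
  qed
qed

end
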